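(* Let $0<\beta<\gamma<1$, $0\le\mu\le1$, $p>1/\beta$, and $x_0\in\mathbb{R}$. Let $l$ be a nonnegative function with $t^{(1-\mu)(1-\beta)}l(t)\in C(0,+\infty)\cap L^{p}_{Loc}[0,+\infty)$, and let $k$ be a nonnegative function with $t^{1-\beta}k(t)\in C(0,+\infty)\cap L^{p}_{Loc}[0,+\infty)$. Suppose there exists a nonnegative constant $K$ such that $t^{\gamma}l(t)\le K$ and $t^{\gamma}k(t)\le K$ for all $t\in[1,+\infty)$. Suppose $f:(0,+\infty)\times\mathbb{R}\to\mathbb{R}$ is a continuous function and $$|f(t,x)|\le l(t)|x|^{\mu}+k(t)\qquad\text{for all }(t,x)\in(0,+\infty)\times\mathbb{R}.$$ Then the Riemann-Liouville fractional differential equation $$D_{0^{+}}^{\beta}x(t)=f(t,x(t)),\quad t\in(0,+\infty),\qquad \lim_{t\to0^{+}}t^{1-\beta}x(t)=x_{0},$$ has at least one solution $x\in C_{1-\beta}(0,+\infty)$ with $\lim_{t\to+\infty}x(t)=0$.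
   Context: The Riemann-Liouville fractional integral of order $\alpha\in(0,1)$ is $I_{0^{+}}^{\alpha}\rho(t)=\frac{1}{\Gamma(\alpha)}\int_{0}^{t}(t-s)^{\alpha-1}\rho(s)\,ds$. The Riemann-Liouville fractional derivative of order $\beta\in(0,1)$ is $D_{0^{+}}^{\beta}\rho(t)=\frac{d}{dt}I_{0^{+}}^{1-\beta}\rho(t)=\frac{1}{\Gamma(1-\beta)}\frac{d}{dt}\int_{0}^{t}(t-s)^{-\beta}\rho(s)\,ds$, where $I_{0^{+}}^{1-\beta}\rho$ is an absolutely continuous function. For $\alpha\in(0,1)$, $C_{\alpha}(0,+\infty)$ is the set of continuous real-valued functions $x$ on $(0,+\infty)$ such that $t^{\alpha}x(t)$ is (extends to) a continuous function on $[0,+\infty)$. $C(0,+\infty)$ is the set of continuous real-valued functions on $(0,+\infty)$, and $L^{p}_{Loc}[0,+\infty)$ is the space of real-valued functions $f$ for which $|f|^{p}$ is Lebesgue integrable over every bounded subinterval of $[0,+\infty)$. A solution is a function satisfying both the differential equation for all $t\in(0,+\infty)$ and the initial condition. When $\mu=0$, $|x|^{\mu}=1$ for all $x$, including $x=0$. *)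

theory Defs
  imports "HOL-Analysis.Analysis"
begin

text \<open>Functions on \<open>(0, \<infinity>)\<close> are modelled as total functions \<^typ>\<open>real \<Rightarrow> real\<close>; no notion below
  depends on their values outside \<open>(0, \<infinity>)\<close>.\<close>

definition RL_integral :: "real \<Rightarrow> (real \<Rightarrow> real) \<Rightarrow> real \<Rightarrow> real" where
  "RL_integral \<alpha> \<rho> t = 1 / Gamma \<alpha> * (LINT s:{0<..<t}|lebesgue. (t - s) powr (\<alpha> - 1) * \<rho> s)"

text \<open>The usual \<open>\<epsilon>\<close>-\<open>\<delta>\<close> definition.  The elements of a division \<open>\<D>\<close> are finitely many compact
  intervals with pairwise disjoint interiors; their union \<open>T\<close> has to lie in \<open>S\<close>.\<close>

definition absolutely_continuous_on :: "real set \<Rightarrow> (real \<Rightarrow> real) \<Rightarrow> bool" where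
  "absolutely_continuous_on S F \<longleftrightarrow>
     (\<forall>\<epsilon>>0. \<exists>\<delta>>0. \<forall>\<D> T. \<D> division_of T \<and> T \<subseteq> S \<and> (\<Sum>J\<in>\<D>. Sup J - Inf J) < \<delta>
        \<longrightarrow> (\<Sum>J\<in>\<D>. \<bar>F (Sup J) - F (Inf J)\<bar>) < \<epsilon>)"

text \<open>\<open>g\<close> is the Riemann-Liouville derivative of order \<open>\<beta>\<close> of \<open>\<rho>\<close> on all of \<open>(0, \<infinity>)\<close>.  Integrability
  is demanded explicitly because the library integral of a non-integrable function is 0.  Absolute
  continuity is on the open half-line since the formula for \<^const>\<open>RL_integral\<close> gives 0 at
  \<open>t = 0\<close>, which in general differs from the limit at \<open>0+\<close> (take \<open>\<rho> s = s powr (\<beta> - 1)\<close>).\<close>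

definition has_RL_derivative :: "real \<Rightarrow> (real \<Rightarrow> real) \<Rightarrow> (real \<Rightarrow> real) \<Rightarrow> bool" where
  "has_RL_derivative \<beta> \<rho> g \<longleftrightarrow>
     (\<forall>t>0. set_integrable lebesgue {0<..<t} (\<lambda>s. (t - s) powr (- \<beta>) * \<rho> s)) \<and>
     absolutely_continuous_on {0<..} (RL_integral (1 - \<beta>) \<rho>) \<and>
     (\<forall>t>0. (RL_integral (1 - \<beta>) \<rho> has_real_derivative g t) (at t))"

definition C_weighted :: "real \<Rightarrow> (real \<Rightarrow> real) set" where
  "C_weighted \<alpha> = {x. continuous_on {0<..} x \<and>
     (\<exists>y. continuous_on {0..} y \<and> (\<forall>t>0. y t = t powr \<alpha> * x t))}"

text \<open>The value of \<open>g\<close> at 0 is immaterial, \<open>{0}\<close> being a null set.\<close>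

definition Lp_loc :: "real \<Rightarrow> (real \<Rightarrow> real) set" where
  "Lp_loc p = {g. set_borel_measurable lebesgue {0..} g \<and>
     (\<forall>J. is_interval J \<and> bounded J \<and> J \<subseteq> {0..} \<longrightarrow> set_integrable lebesgue J (\<lambda>t. \<bar>g t\<bar> powr p))}"

text \<open>\<open>|x|\<^sup>\<mu>\<close> with the convention \<open>|x|\<^sup>0 = 1\<close> also for \<open>x = 0\<close>; the library has \<open>0 powr 0 = 0\<close>.\<close>

definition abs_pow :: "real \<Rightarrow> real \<Rightarrow> real" where
  "abs_pow x \<mu> = (if \<mu> = 0 then 1 else \<bar>x\<bar> powr \<mu>)"

definition RL_solution :: "real \<Rightarrow> (real \<Rightarrow> real \<Rightarrow> real) \<Rightarrow> real \<Rightarrow> (real \<Rightarrow> real) \<Rightarrow> bool" where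
  "RL_solution \<beta> f x0 x \<longleftrightarrow>
     has_RL_derivative \<beta> x (\<lambda>t. f t (x t)) \<and>
     ((\<lambda>t. t powr (1 - \<beta>) * x t) \<longlongrightarrow> x0) (at_right 0)"

end

theory Submission
  imports Defs "HOL-Complex_Analysis.Great_Picard"
begin

text \<open>
  Put \<open>y(t) = t\<^bsup>1-\<beta>\<^esup> x(t)\<close>.  It suffices to solve the Volterra equation
  \<open>y(t) = x\<^sub>0 + t\<^bsup>1-\<beta>\<^esup> / \<Gamma>(\<beta>) \<integral>\<^sub>0\<^sup>t (t - s)\<^bsup>\<beta>-1\<^esup> g(s) ds\<close> with \<open>g(s) = f(s, s\<^bsup>\<beta>-1\<^esup> y(s))\<close>, and the
  growth condition bounds \<open>g\<close> by \<open>w(s) max(1, |y(s)|)\<close>, where \<open>w(s) = s\<^bsup>-\<mu>(1-\<beta>)\<^esup> l(s) + k(s)\<close> is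
  \<open>s\<^bsup>\<beta>-1\<^esup>\<close> times a function in \<open>L\<^sup>p\<close> on bounded intervals.

  The condition \<open>p > 1/\<beta>\<close> is used only through one estimate (\<open>abel_weight_bound\<close>): for some \<open>\<epsilon> > 0\<close>,
  \<open>t\<^bsup>1-\<beta>\<^esup> \<integral>\<^sub>0\<^sup>t (t - s)\<^bsup>\<beta>-1-\<epsilon>\<^esup> w(s) ds\<close> stays bounded on bounded intervals, although the kernel is
  more singular than the one in the equation.  The spare exponent \<open>\<epsilon>\<close> serves three purposes: as a
  factor \<open>t\<^sup>\<epsilon>\<close> it gives the initial condition, as a factor \<open>|t - t'|\<^sup>\<epsilon>\<close> it gives equicontinuity of
  all integrals with dominated densities (\<open>abel_diff_le\<close>), and through
  \<open>exp(-\<kappa>u) \<le> (\<kappa>u)\<^bsup>-\<epsilon>\<^esup>\<close> it makes the integral operator small in an exponentially weighted norm.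

  The last point yields a global a priori bound in the form of a nondecreasing supersolution \<open>B\<close>
  (\<open>linear_growth_supersolution\<close>): \<open>B\<close> grows exponentially up to a large time \<open>T\<^sub>0\<close> and like
  \<open>t\<^bsup>1-\<beta>\<^esup>\<close>, that is, with \<open>x\<close> bounded, afterwards.  Beyond \<open>T\<^sub>0\<close> the decay \<open>t\<^bsup>-\<gamma>\<^esup>\<close> of the
  coefficients with \<open>\<gamma> > \<beta>\<close> makes the remaining part of the operator a contraction of the bound.

  A solution below \<open>B\<close> is obtained by compactness (\<open>fixed_point_exists\<close>).  If the argument of \<open>y\<close>
  under the integral is delayed by \<open>1/n\<close>, the equation is solved by finitely many iterations on
  every bounded interval, and every iterate stays below \<open>B\<close> because \<open>B\<close> is nondecreasing.
  The approximate solutions are equicontinuous at each point of \<open>(0, \<infinity>)\<close>, so a subsequence that converges at the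
  positive rationals converges everywhere, and dominated convergence passes to the limit.

  Finally the semigroup property of Abel integrals (\<open>abel_abel\<close>) turns the Volterra equation into
  \<open>I\<^bsup>1-\<beta>\<^esup> x(t) = x\<^sub>0 \<Gamma>(\<beta>) + \<integral>\<^sub>0\<^sup>t g(s) ds\<close>, which gives absolute continuity and the derivative, and the
  decay of \<open>g\<close> gives \<open>x(t) \<rightarrow> 0\<close> (\<open>solution_of_fixed_point\<close>).
\<close>

section \<open>Abel integrals\<close>

lemma has_bochner_integral_beta:
  fixes a b r t :: real
  assumes "a > 0" "b > 0" "r < t"
  shows "has_bochner_integral lborel
    (\<lambda>s. indicator {r<..<t} s * ((t - s) powr (a - 1) * (s - r) powr (b - 1)))
    ((t - r) powr (a + b - 1) * Beta a b)"
proof -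
  define d where "d = t - r"
  have d: "d > 0" using assms by (simp add: d_def)
  let ?\<phi> = "\<lambda>u::real. indicator {0..1} u * (u powr (a - 1) * (1 - u) powr (b - 1))"
  have "has_bochner_integral lborel ?\<phi> (Beta a b)"
    using integrable_Beta[OF assms(1,2)] set_borel_integral_eq_integral(2)[OF integrable_Beta[OF assms(1,2)]]
      integral_unique[OF has_integral_Beta_real[OF assms(1,2)]]
    by (simp add: has_bochner_integral_iff set_integrable_def set_lebesgue_integral_def)
  then have "has_bochner_integral lborel (\<lambda>s. ?\<phi> (t / d + (- (1 / d)) * s)) (Beta a b /\<^sub>R \<bar>- (1 / d)\<bar>)"
    using d by (subst (asm) lborel_has_bochner_integral_real_affine_iff[of "- (1 / d)" _ _ "t / d"]) auto
  then have "has_bochner_integral lborel (\<lambda>s. d powr (a + b - 2) * ?\<phi> (t / d + (- (1 / d)) * s))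
      (d powr (a + b - 2) * (Beta a b /\<^sub>R \<bar>- (1 / d)\<bar>))"
    by (rule has_bochner_integral_mult_right)
  moreover have "d powr (a + b - 2) * (Beta a b /\<^sub>R \<bar>- (1 / d)\<bar>) = d powr (a + b - 1) * Beta a b"
  proof -
    have "d powr (a + b - 1) = d powr (a + b - 2) * d"
      using d powr_add[of d "a + b - 2" 1] by (simp add: algebra_simps)
    then show ?thesis using d by simp
  qed
  moreover have "d powr (a + b - 2) * ?\<phi> (t / d + (- (1 / d)) * s)
      = indicator {r<..<t} s * ((t - s) powr (a - 1) * (s - r) powr (b - 1))" for s
  proof -
    have u: "t / d + (- (1 / d)) * s = (t - s) / d" "1 - (t - s) / d = (s - r) / d"
    proof -
      have "(s - r) / d = (d - (t - s)) / d" by (simp add: d_def)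
      then show "1 - (t - s) / d = (s - r) / d" using d by (simp add: diff_divide_distrib)
    qed (simp add: diff_divide_distrib)
    show ?thesis
    proof (cases "s \<in> {r<..<t}")
      case True
      then have "(t - s) / d \<in> {0..1}" using d by (auto simp: d_def field_simps)
      moreover have "d powr (a + b - 2) = d powr (a - 1) * d powr (b - 1)"
        by (simp add: powr_add[symmetric] algebra_simps)
      ultimately show ?thesis
        using True d unfolding u by (simp add: powr_divide)
    next
      case False
      then consider "s = r" | "s = t" | "s < r" | "s > t" by fastforce
      then have "?\<phi> ((t - s) / d) = 0"
      proof cases
        case 3
        then have "(t - s) / d > 1" using d by (simp add: d_def field_simps)
        then show ?thesis by simp
      next
        case 4
        then have "(t - s) / d < 0" using d by (simp add: field_simps)
        then show ?thesis by simp
      qed (use d in \<open>auto simp: d_def\<close>)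
      then show ?thesis using False unfolding u by simp
    qed
  qed
  ultimately show ?thesis unfolding d_def[symmetric] by (simp only:)
qed

text \<open>This is \<open>\<Gamma>(c + 1)\<close> times the Riemann-Liouville integral of order \<open>c + 1\<close>.  The exponent itself is
  the parameter because the estimates compare different kernels with one density.\<close>

definition abel :: "real \<Rightarrow> (real \<Rightarrow> real) \<Rightarrow> real \<Rightarrow> real" where
  "abel c g t = (LINT s:{0<..<t}|lborel. (t - s) powr c * g s)"

abbreviation abel_integrable :: "real \<Rightarrow> (real \<Rightarrow> real) \<Rightarrow> real \<Rightarrow> bool" where
  "abel_integrable c g t \<equiv> set_integrable lborel {0<..<t} (\<lambda>s. (t - s) powr c * g s)"

lemma abel_nonpos [simp]: "t \<le> 0 \<Longrightarrow> abel c g t = 0"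
  by (simp add: abel_def set_lebesgue_integral_def)

lemma abel_powr:
  assumes "a > 0" "b > 0" "t > 0"
  shows "abel_integrable (a - 1) (\<lambda>s. s powr (b - 1)) t"
    and "abel (a - 1) (\<lambda>s. s powr (b - 1)) t = t powr (a + b - 1) * Beta a b"
  using has_bochner_integral_beta[of a b 0 t] assms
  by (simp_all add: has_bochner_integral_iff abel_def set_integrable_def set_lebesgue_integral_def)

lemma set_integrable_powr:
  fixes t c :: real
  assumes "c > -1" "t > 0"
  shows "set_integrable lborel {0<..<t} (\<lambda>s. s powr c)"
    and "(LINT s:{0<..<t}|lborel. s powr c) = t powr (c + 1) / (c + 1)"
    and "set_integrable lborel {0<..<t} (\<lambda>s. (t - s) powr c)"
    and "(LINT s:{0<..<t}|lborel. (t - s) powr c) = t powr (c + 1) / (c + 1)"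
proof -
  have B: "Beta 1 (c + 1) = 1 / (c + 1)" "Beta (c + 1) 1 = 1 / (c + 1)"
  proof -
    have "Gamma (c + 2) = (c + 1) * Gamma (c + 1)" "Gamma (c + 1) > 0"
      using assms Gamma_plus1[of "c + 1"] Gamma_real_pos[of "c + 1"] nonpos_Ints_nonpos[of "c + 1"]
      by (auto simp: add.assoc)
    moreover from this have "Gamma (c + 1) \<noteq> 0" by linarith
    ultimately show "Beta 1 (c + 1) = 1 / (c + 1)" "Beta (c + 1) 1 = 1 / (c + 1)"
      using assms by (simp_all add: Beta_def add.assoc add.left_commute[of 1])
  qed
  have "(\<lambda>s. indicator {0<..<t} s * ((t - s) powr (1 - 1) * (s - 0) powr (c + 1 - 1)))
      = (\<lambda>s. indicator {0<..<t} s * s powr c)"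
    by (auto simp: fun_eq_iff indicator_def)
  with has_bochner_integral_beta[of 1 "c + 1" 0 t] assms B
  have "has_bochner_integral lborel (\<lambda>s. indicator {0<..<t} s * s powr c) (t powr (c + 1) / (c + 1))"
    by (simp add: add.commute)
  then show "set_integrable lborel {0<..<t} (\<lambda>s. s powr c)"
    "(LINT s:{0<..<t}|lborel. s powr c) = t powr (c + 1) / (c + 1)"
    by (simp_all add: has_bochner_integral_iff set_integrable_def set_lebesgue_integral_def)
  have "(\<lambda>s. indicator {0<..<t} s * ((t - s) powr (c + 1 - 1) * (s - 0) powr (1 - 1)))
      = (\<lambda>s. indicator {0<..<t} s * (t - s) powr c)"
    by (auto simp: fun_eq_iff indicator_def)
  with has_bochner_integral_beta[of "c + 1" 1 0 t] assms B
  have "has_bochner_integral lborel (\<lambda>s. indicator {0<..<t} s * (t - s) powr c) (t powr (c + 1) / (c + 1))"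
    by (simp add: add.commute)
  then show "set_integrable lborel {0<..<t} (\<lambda>s. (t - s) powr c)"
    "(LINT s:{0<..<t}|lborel. (t - s) powr c) = t powr (c + 1) / (c + 1)"
    by (simp_all add: has_bochner_integral_iff set_integrable_def set_lebesgue_integral_def)
qed

lemma set_borel_measurable_lborel [intro]:
  "A \<in> sets borel \<Longrightarrow> g \<in> borel_measurable borel \<Longrightarrow> set_borel_measurable lborel A (g :: real \<Rightarrow> real)"
  unfolding set_borel_measurable_def
  by (intro borel_measurable_scaleR borel_measurable_indicator) auto

lemma set_integrable_dominated:
  fixes g h :: "real \<Rightarrow> real"
  assumes "set_integrable lborel A h" "A \<in> sets borel" "g \<in> borel_measurable borel"
    and "\<And>s. s \<in> A \<Longrightarrow> \<bar>g s\<bar> \<le> h s"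
  shows "set_integrable lborel A g" and "\<bar>LINT s:A|lborel. g s\<bar> \<le> (LINT s:A|lborel. h s)"
proof -
  show I: "set_integrable lborel A g"
    by (rule set_integrable_bound[OF assms(1)])
      (use assms in \<open>force intro!: set_borel_measurable_lborel AE_I2\<close>)+
  have "\<bar>LINT s:A|lborel. g s\<bar> \<le> (LINT s:A|lborel. \<bar>g s\<bar>)"
    using integral_abs_bound[of lborel "\<lambda>s. indicator A s *\<^sub>R g s"]
    by (simp add: set_lebesgue_integral_def abs_mult)
  also have "\<dots> \<le> (LINT s:A|lborel. h s)"
    by (intro set_integral_mono set_integrable_abs I assms)
  finally show "\<bar>LINT s:A|lborel. g s\<bar> \<le> (LINT s:A|lborel. h s)" .
qed

lemma abel_dominated:
  assumes "abel_integrable c h t" "g \<in> borel_measurable borel"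
    and "\<And>s. 0 < s \<Longrightarrow> s < t \<Longrightarrow> \<bar>g s\<bar> \<le> h s"
  shows "abel_integrable c g t" and "\<bar>abel c g t\<bar> \<le> abel c h t"
proof -
  have *: "\<bar>(t - s) powr c * g s\<bar> \<le> (t - s) powr c * h s" if "s \<in> {0<..<t}" for s
    using that assms(3)[of s] by (auto simp: abs_mult intro!: mult_left_mono)
  have m: "(\<lambda>s. (t - s) powr c * g s) \<in> borel_measurable borel" using assms(2) by measurable
  from set_integrable_dominated[OF assms(1) _ m *]
  show "abel_integrable c g t" and "\<bar>abel c g t\<bar> \<le> abel c h t"
    unfolding abel_def by auto
qed

lemma abel_nonneg:
  assumes "\<And>s. 0 < s \<Longrightarrow> s < t \<Longrightarrow> 0 \<le> g s"
  shows "0 \<le> abel c g t"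
  unfolding abel_def set_lebesgue_integral_def
  by (rule Bochner_Integration.integral_nonneg) (use assms in \<open>auto simp: indicator_def\<close>)

lemma abel_cong:
  assumes "\<And>s. 0 < s \<Longrightarrow> s < t \<Longrightarrow> g s = g' s"
  shows "abel c g t = abel c g' t"
  unfolding abel_def set_lebesgue_integral_def
  by (rule Bochner_Integration.integral_cong) (use assms in \<open>auto simp: indicator_def\<close>)

lemma abel_tendsto:
  assumes "abel_integrable c h t" "\<And>n. v n \<in> borel_measurable borel" "g \<in> borel_measurable borel"
    and "\<And>n s. 0 < s \<Longrightarrow> \<bar>v n s\<bar> \<le> h s"
    and "\<And>s. 0 < s \<Longrightarrow> (\<lambda>n. v n s) \<longlonglongrightarrow> g s"
  shows "(\<lambda>n. abel c (v n) t) \<longlonglongrightarrow> abel c g t"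
  unfolding abel_def set_lebesgue_integral_def
proof (rule integral_dominated_convergence)
  show "integrable lborel (\<lambda>s. indicator {0<..<t} s *\<^sub>R ((t - s) powr c * h s))"
    using assms(1) by (simp add: set_integrable_def)
  show "(\<lambda>s. indicator {0<..<t} s *\<^sub>R ((t - s) powr c * g s)) \<in> borel_measurable lborel"
    using assms(3) by measurable
  show "(\<lambda>s. indicator {0<..<t} s *\<^sub>R ((t - s) powr c * v n s)) \<in> borel_measurable lborel" for n
    using assms(2)[of n] by measurable
  show "AE s in lborel. (\<lambda>n. indicator {0<..<t} s *\<^sub>R ((t - s) powr c * v n s))
      \<longlonglongrightarrow> indicator {0<..<t} s *\<^sub>R ((t - s) powr c * g s)"
    using assms(5) by (intro AE_I2) (auto simp: indicator_def intro!: tendsto_intros)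
  show "AE s in lborel. norm (indicator {0<..<t} s *\<^sub>R ((t - s) powr c * v n s))
      \<le> indicator {0<..<t} s *\<^sub>R ((t - s) powr c * h s)" for n
    using assms(4)[of _ n] by (intro AE_I2) (auto simp: indicator_def abs_mult intro!: mult_left_mono)
qed

text \<open>A less singular kernel is bounded by a more singular one, and the difference of the exponents
  comes out as a power of \<open>t\<close>.\<close>

lemma abel_integrable_weaken:
  assumes "abel_integrable d h t" "d \<le> c" "h \<in> borel_measurable borel" "0 < t"
    and "\<And>s. 0 < s \<Longrightarrow> 0 \<le> h s"
  shows "abel_integrable c h t" and "abel c h t \<le> t powr (c - d) * abel d h t"
proof -
  have le: "\<bar>(t - s) powr c * h s\<bar> \<le> t powr (c - d) * ((t - s) powr d * h s)" if "s \<in> {0<..<t}" for s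
  proof -
    have "(t - s) powr c = (t - s) powr (c - d) * (t - s) powr d" by (simp add: powr_add[symmetric])
    also have "\<dots> \<le> t powr (c - d) * (t - s) powr d"
      using that assms by (intro mult_right_mono powr_mono2) auto
    finally show ?thesis using assms(5)[of s] that
      by (simp add: abs_mult mult.assoc[symmetric] mult_right_mono)
  qed
  have m: "(\<lambda>s. (t - s) powr c * h s) \<in> borel_measurable borel" using assms(3) by measurable
  have "set_integrable lborel {0<..<t} (\<lambda>s. t powr (c - d) * ((t - s) powr d * h s))"
    using assms(1) by (rule set_integrable_mult_right)
  from set_integrable_dominated[OF this _ m le]
  show "abel_integrable c h t" and "abel c h t \<le> t powr (c - d) * abel d h t"
    unfolding abel_def by auto
qed

section \<open>Densities with a singularity at zero\<close>

lemma powr_add_le_add_powr: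
  fixes x y r :: real
  assumes "0 < x" "0 < y" "0 \<le> r" "r \<le> 1"
  shows "(x + y) powr r \<le> x powr r + y powr r"
proof -
  have *: "x / (x + y) \<le> (x / (x + y)) powr r" if "0 < x" "0 < y" for x y :: real
    using powr_mono'[of r 1 "x / (x + y)"] that assms by simp
  have "1 = x / (x + y) + y / (x + y)" using assms by (simp add: add_divide_distrib[symmetric])
  also have "\<dots> \<le> (x / (x + y)) powr r + (y / (x + y)) powr r"
    using *[of x y] *[of y x] assms by (simp add: add.commute)
  also have "\<dots> = (x powr r + y powr r) / (x + y) powr r"
    using assms by (simp add: powr_divide add_divide_distrib)
  finally show ?thesis using assms by (simp add: field_simps)
qed

text \<open>The smaller of the two bases carries both negative exponents.\<close>

lemma powr_minus_mult_le:
  fixes u v a b :: real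
  assumes "0 < u" "0 < v" "0 \<le> a" "0 \<le> b"
  shows "u powr (- a) * v powr (- b) \<le> u powr (- (a + b)) + v powr (- (a + b))"
proof (cases "u \<le> v")
  case True
  then have "v powr (- b) \<le> u powr (- b)" using assms by (intro powr_mono2') auto
  then have "u powr (- a) * v powr (- b) \<le> u powr (- a) * u powr (- b)"
    by (intro mult_left_mono) auto
  also have "\<dots> = u powr (- (a + b))" by (simp add: powr_add[symmetric])
  finally show ?thesis using powr_ge_zero[of v "- (a + b)"] by linarith
next
  case False
  then have "u powr (- a) \<le> v powr (- a)" using assms by (intro powr_mono2') auto
  then have "u powr (- a) * v powr (- b) \<le> v powr (- a) * v powr (- b)"
    by (intro mult_right_mono) auto
  also have "\<dots> = v powr (- (a + b))" by (simp add: powr_add[symmetric])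
  finally show ?thesis using powr_ge_zero[of u "- (a + b)"] by linarith
qed

text \<open>The weight separates the singularities at \<open>s = 0\<close> and \<open>s = t\<close>: with \<open>u = t - s\<close>,
  \<open>t\<^bsup>1-\<beta>\<^esup> u\<^bsup>\<beta>-1\<^esup> s\<^bsup>\<beta>-1\<^esup> = (1/s + 1/u)\<^bsup>1-\<beta>\<^esup>\<close>, and the power \<open>1 - \<beta>\<close> is subadditive.\<close>

lemma weighted_kernel_le:
  fixes \<beta> \<epsilon> s t :: real
  assumes "0 < s" "s < t" "0 < \<beta>" "\<beta> < 1" "0 \<le> \<epsilon>"
  shows "t powr (1 - \<beta>) * ((t - s) powr (\<beta> - 1 - \<epsilon>) * s powr (\<beta> - 1))
    \<le> 2 * (s powr (- (1 - \<beta> + \<epsilon>)) + (t - s) powr (- (1 - \<beta> + \<epsilon>)))"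
proof -
  define u where "u = t - s"
  have u: "u > 0" "t = s + u" using assms by (auto simp: u_def)
  have "t powr (1 - \<beta>) * (u powr (\<beta> - 1 - \<epsilon>) * s powr (\<beta> - 1))
      = (u powr (\<beta> - 1) * s powr (\<beta> - 1) * t powr (1 - \<beta>)) * u powr (- \<epsilon>)"
    using powr_add[of u "\<beta> - 1" "- \<epsilon>"] by simp
  also have "u powr (\<beta> - 1) * s powr (\<beta> - 1) * t powr (1 - \<beta>)
      \<le> u powr (\<beta> - 1) * s powr (\<beta> - 1) * (s powr (1 - \<beta>) + u powr (1 - \<beta>))"
    using assms u powr_add_le_add_powr[of s u "1 - \<beta>"] by (intro mult_left_mono) auto
  also have "\<dots> = u powr (\<beta> - 1) * (s powr (\<beta> - 1) * s powr (1 - \<beta>)) +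
       s powr (\<beta> - 1) * (u powr (\<beta> - 1) * u powr (1 - \<beta>))"
    by (simp add: algebra_simps)
  also have "\<dots> = u powr (- (1 - \<beta>)) + s powr (- (1 - \<beta>))"
    using u assms by (simp add: powr_add[symmetric])
  finally have "t powr (1 - \<beta>) * (u powr (\<beta> - 1 - \<epsilon>) * s powr (\<beta> - 1))
      \<le> (u powr (- (1 - \<beta>)) + s powr (- (1 - \<beta>))) * u powr (- \<epsilon>)"
    by (simp add: mult_right_mono)
  also have "\<dots> = u powr (- (1 - \<beta> + \<epsilon>)) + s powr (- (1 - \<beta>)) * u powr (- \<epsilon>)"
    by (simp add: distrib_right powr_add[symmetric])
  also have "s powr (- (1 - \<beta>)) * u powr (- \<epsilon>)
      \<le> s powr (- (1 - \<beta> + \<epsilon>)) + u powr (- (1 - \<beta> + \<epsilon>))"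
    using assms u by (intro powr_minus_mult_le) auto
  also have "u powr (- (1 - \<beta> + \<epsilon>)) + (s powr (- (1 - \<beta> + \<epsilon>)) + u powr (- (1 - \<beta> + \<epsilon>)))
     \<le> 2 * (s powr (- (1 - \<beta> + \<epsilon>)) + u powr (- (1 - \<beta> + \<epsilon>)))"
    by simp
  finally show ?thesis by (simp add: u_def)
qed

text \<open>By the previous lemma only products of \<open>m\<close> with powers \<open>v\<^bsup>-c\<^esup>\<close> of \<open>v = s\<close> and \<open>v = t - s\<close> have
  to be integrated, where \<open>c = 1 - \<beta> + \<epsilon>\<close>.  Young's inequality with the conjugate exponent \<open>q\<close> separates the factors, and
  \<open>v\<^bsup>-cq\<^esup>\<close> is integrable at \<open>0\<close> exactly when \<open>\<epsilon> < \<beta> - 1/p\<close>.\<close>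

lemma abel_weight_bound:
  fixes \<beta> \<epsilon> p T :: real and m :: "real \<Rightarrow> real"
  assumes \<beta>: "0 < \<beta>" "\<beta> < 1" and p: "p > 1 / \<beta>" and \<epsilon>: "0 < \<epsilon>" "\<epsilon> < \<beta> - 1 / p"
    and m: "m \<in> borel_measurable borel" "\<And>s. 0 \<le> m s"
    and mp: "set_integrable lborel {0<..T} (\<lambda>s. m s powr p)" and T: "T > 0"
  shows "\<exists>C. \<forall>t. 0 < t \<and> t \<le> T \<longrightarrow>
    abel_integrable (\<beta> - 1 - \<epsilon>) (\<lambda>s. s powr (\<beta> - 1) * m s) t \<and>
    t powr (1 - \<beta>) * abel (\<beta> - 1 - \<epsilon>) (\<lambda>s. s powr (\<beta> - 1) * m s) t \<le> C"
proof -
  have p1: "p > 1" using \<beta> p by (smt (verit) less_divide_eq_1_pos)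
  define q where "q = p / (p - 1)"
  have q: "q > 1" "1 / p + 1 / q = 1" using p1 by (auto simp: q_def field_simps)
  define c where "c = 1 - \<beta> + \<epsilon>"
  have c: "c > 0" "c * q < 1"
  proof -
    show "c > 0" using \<beta> \<epsilon> by (simp add: c_def)
    have "c < 1 - 1 / p" using \<epsilon> by (simp add: c_def)
    also have "\<dots> = 1 / q" using q by simp
    finally show "c * q < 1" using q by (simp add: field_simps)
  qed
  let ?P = "LINT s:{0<..T}|lborel. m s powr p"
  let ?R = "T powr (1 - c * q) / (1 - c * q)"
  have main: "abel_integrable (\<beta> - 1 - \<epsilon>) (\<lambda>s. s powr (\<beta> - 1) * m s) t \<and>
    t powr (1 - \<beta>) * abel (\<beta> - 1 - \<epsilon>) (\<lambda>s. s powr (\<beta> - 1) * m s) t \<le> 4 * ?P + 4 * ?R"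
    if t: "0 < t" "t \<le> T" for t
  proof -
    let ?k = "\<lambda>s. t powr (1 - \<beta>) * ((t - s) powr (\<beta> - 1 - \<epsilon>) * (s powr (\<beta> - 1) * m s))"
    let ?d = "\<lambda>s. 4 * m s powr p + 2 * (s powr (- (c * q)) + (t - s) powr (- (c * q)))"
    have yo: "v powr (- c) * m s \<le> v powr (- (c * q)) + m s powr p" if "v > 0" for v s
    proof -
      have "v powr (- c) * m s \<le> (v powr (- c)) powr q / q + m s powr p / p"
        using Youngs_inequality[of q p "v powr (- c)" "m s"] p1 q m by (simp add: add.commute)
      also have "\<dots> \<le> (v powr (- c)) powr q / 1 + m s powr p / 1"
        using p1 q by (intro add_mono divide_left_mono) auto
      finally show ?thesis by (simp add: powr_powr)
    qed
    have le: "\<bar>?k s\<bar> \<le> ?d s" if "s \<in> {0<..<t}" for s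
    proof -
      have "\<bar>?k s\<bar> = t powr (1 - \<beta>) * ((t - s) powr (\<beta> - 1 - \<epsilon>) * s powr (\<beta> - 1)) * m s"
        using m by (simp add: abs_mult)
      also have "\<dots> \<le> 2 * (s powr (- c) + (t - s) powr (- c)) * m s"
        unfolding c_def using that \<beta> \<epsilon> m by (intro mult_right_mono weighted_kernel_le) auto
      also have "\<dots> \<le> ?d s"
        using yo[of s s] yo[of "t - s" s] that by (simp add: algebra_simps)
      finally show ?thesis .
    qed
    have mt: "set_integrable lborel {0<..<t} (\<lambda>s. m s powr p)"
      by (rule set_integrable_subset[OF mp]) (use t in auto)
    have cq: "- (c * q) > - 1" using c by simp
    note P = set_integrable_powr[OF cq t(1)]
    have Id: "set_integrable lborel {0<..<t} ?d"
      by (intro set_integral_add set_integrable_mult_right mt P)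
    have "(LINT s:{0<..<t}|lborel. ?d s) =
      4 * (LINT s:{0<..<t}|lborel. m s powr p) + 2 * (t powr (1 - c * q) / (1 - c * q) + t powr (1 - c * q) / (1 - c * q))"
      using mt P by (simp add: set_integral_add)
    also have "(LINT s:{0<..<t}|lborel. m s powr p) \<le> ?P"
      using mt mp t unfolding set_lebesgue_integral_def set_integrable_def
      by (intro integral_mono) (auto simp: indicator_def)
    also have "t powr (1 - c * q) / (1 - c * q) \<le> ?R"
      using c t by (intro divide_right_mono powr_mono2) auto
    finally have d: "(LINT s:{0<..<t}|lborel. ?d s) \<le> 4 * ?P + 4 * ?R" by simp
    have km: "?k \<in> borel_measurable borel" using m by measurable
    from set_integrable_dominated[OF Id _ km le]
    have "set_integrable lborel {0<..<t} ?k" "\<bar>LINT s:{0<..<t}|lborel. ?k s\<bar> \<le> (LINT s:{0<..<t}|lborel. ?d s)"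
      by auto
    then show ?thesis using d t unfolding abel_def by simp
  qed
  then show ?thesis by blast
qed

section \<open>Continuity of Abel integrals\<close>

text \<open>With \<open>r = a/b \<in> (0, 1)\<close> the difference is \<open>a\<^bsup>\<beta>-1\<^esup> (1 - r\<^bsup>1-\<beta>\<^esup>)\<close>, and
  \<open>1 - r\<^bsup>1-\<beta>\<^esup> \<le> 1 - r \<le> (1 - r)\<^sup>\<epsilon> \<le> ((b - a)/a)\<^sup>\<epsilon>\<close>.\<close>

lemma kernel_diff_le:
  fixes a b \<beta> \<epsilon> :: real
  assumes "0 < a" "a < b" "0 < \<beta>" "\<beta> < 1" "0 < \<epsilon>" "\<epsilon> \<le> 1"
  shows "\<bar>a powr (\<beta> - 1) - b powr (\<beta> - 1)\<bar> \<le> (b - a) powr \<epsilon> * a powr (\<beta> - 1 - \<epsilon>)"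
proof -
  have "b powr (\<beta> - 1) = a powr (\<beta> - 1) * (a / b) powr (1 - \<beta>)"
    using assms powr_minus_divide[of b "1 - \<beta>"]
    by (simp add: powr_divide powr_add[symmetric])
  moreover have "b powr (\<beta> - 1) \<le> a powr (\<beta> - 1)" using assms by (intro powr_mono2') auto
  ultimately have "\<bar>a powr (\<beta> - 1) - b powr (\<beta> - 1)\<bar> = a powr (\<beta> - 1) * (1 - (a / b) powr (1 - \<beta>))"
    by (simp add: algebra_simps)
  also have "1 - (a / b) powr (1 - \<beta>) \<le> 1 - a / b"
    using powr_mono'[of "1 - \<beta>" 1 "a / b"] assms by simp
  also have "\<dots> = (b - a) / b" using assms by (simp add: field_simps)
  also have "\<dots> \<le> ((b - a) / b) powr \<epsilon>"
    using powr_mono'[of \<epsilon> 1 "(b - a) / b"] assms by simp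
  also have "\<dots> \<le> ((b - a) / a) powr \<epsilon>"
    using assms by (intro powr_mono2 divide_left_mono) auto
  also have "\<dots> = (b - a) powr \<epsilon> * a powr (- \<epsilon>)"
    using assms by (simp add: powr_divide powr_minus_divide)
  finally have "\<bar>a powr (\<beta> - 1) - b powr (\<beta> - 1)\<bar> \<le> a powr (\<beta> - 1) * ((b - a) powr \<epsilon> * a powr (- \<epsilon>))"
    by (simp add: mult_left_mono)
  also have "\<dots> = (b - a) powr \<epsilon> * a powr (\<beta> - 1 - \<epsilon>)"
    by (simp add: powr_add[symmetric])
  finally show ?thesis .
qed

text \<open>A Hoelder estimate that depends on the density \<open>g\<close> only through its bound \<open>h\<close>, so the integrals of
  all densities below \<open>h\<close> are equicontinuous.\<close>

lemma abel_diff_le: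
  fixes \<beta> \<epsilon> t t' :: real
  assumes b: "0 < \<beta>" "\<beta> < 1" "0 < \<epsilon>" "\<epsilon> \<le> 1" and t: "0 < t" "t < t'"
    and h: "h \<in> borel_measurable borel" "\<And>s. 0 < s \<Longrightarrow> 0 \<le> h s"
    and It: "abel_integrable (\<beta> - 1 - \<epsilon>) h t" and It': "abel_integrable (\<beta> - 1 - \<epsilon>) h t'"
    and g: "g \<in> borel_measurable borel" "\<And>s. 0 < s \<Longrightarrow> \<bar>g s\<bar> \<le> h s"
  shows "\<bar>abel (\<beta> - 1) g t' - abel (\<beta> - 1) g t\<bar>
    \<le> (t' - t) powr \<epsilon> * (abel (\<beta> - 1 - \<epsilon>) h t + abel (\<beta> - 1 - \<epsilon>) h t')"
proof -
  let ?k = "\<lambda>c t s. indicator {0<..<t} s * (t - s) powr c"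
  have Ig: "integrable lborel (\<lambda>s. ?k (\<beta> - 1) t s * g s)" "integrable lborel (\<lambda>s. ?k (\<beta> - 1) t' s * g s)"
    using abel_dominated(1)[OF abel_integrable_weaken(1)[OF It _ h(1) _ h(2)] g(1)]
      abel_dominated(1)[OF abel_integrable_weaken(1)[OF It' _ h(1) _ h(2)] g(1)] b t g
    by (auto simp: set_integrable_def mult.assoc)
  have Ih: "integrable lborel (\<lambda>s. ?k (\<beta> - 1 - \<epsilon>) t s * h s)" "integrable lborel (\<lambda>s. ?k (\<beta> - 1 - \<epsilon>) t' s * h s)"
    using It It' by (auto simp: set_integrable_def mult.assoc)
  have ab: "abel c g t = (LINT s|lborel. ?k c t s * g s)" for c g t
    by (simp add: abel_def set_lebesgue_integral_def mult.assoc)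
  have pw: "\<bar>?k (\<beta> - 1) t' s * g s - ?k (\<beta> - 1) t s * g s\<bar>
     \<le> (t' - t) powr \<epsilon> * (?k (\<beta> - 1 - \<epsilon>) t s * h s + ?k (\<beta> - 1 - \<epsilon>) t' s * h s)" for s
  proof -
    consider "s \<le> 0 \<or> s \<ge> t'" | "0 < s" "s < t" | "0 < s" "t \<le> s" "s < t'" by linarith
    then show ?thesis
    proof cases
      case 1 then show ?thesis using t by (auto simp: indicator_def)
    next
      case 2
      have "\<bar>?k (\<beta> - 1) t' s * g s - ?k (\<beta> - 1) t s * g s\<bar>
        = \<bar>(t - s) powr (\<beta> - 1) - (t' - s) powr (\<beta> - 1)\<bar> * \<bar>g s\<bar>"
        using 2 t by (simp add: left_diff_distrib[symmetric] abs_mult abs_minus_commute)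
      also have "\<dots> \<le> ((t' - t) powr \<epsilon> * (t - s) powr (\<beta> - 1 - \<epsilon>)) * h s"
        using kernel_diff_le[of "t - s" "t' - s" \<beta> \<epsilon>] 2 t b g by (intro mult_mono) auto
      also have "\<dots> \<le> (t' - t) powr \<epsilon> * (?k (\<beta> - 1 - \<epsilon>) t s * h s + ?k (\<beta> - 1 - \<epsilon>) t' s * h s)"
        using 2 t h(2)[of s] by (simp add: distrib_left)
      finally show ?thesis .
    next
      case 3
      have "\<bar>?k (\<beta> - 1) t' s * g s - ?k (\<beta> - 1) t s * g s\<bar> = (t' - s) powr (\<beta> - 1) * \<bar>g s\<bar>"
        using 3 t by (simp add: abs_mult)
      also have "\<dots> = (t' - s) powr \<epsilon> * ((t' - s) powr (\<beta> - 1 - \<epsilon>) * \<bar>g s\<bar>)"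
        by (simp add: mult.assoc[symmetric] powr_add[symmetric])
      also have "\<dots> \<le> (t' - t) powr \<epsilon> * ((t' - s) powr (\<beta> - 1 - \<epsilon>) * \<bar>g s\<bar>)"
        using 3 b by (intro mult_right_mono powr_mono2) auto
      also have "\<dots> \<le> (t' - t) powr \<epsilon> * ((t' - s) powr (\<beta> - 1 - \<epsilon>) * h s)"
        using g(2)[OF 3(1)] by (intro mult_left_mono) auto
      also have "\<dots> = (t' - t) powr \<epsilon> * (?k (\<beta> - 1 - \<epsilon>) t s * h s + ?k (\<beta> - 1 - \<epsilon>) t' s * h s)"
        using 3 t by simp
      finally show ?thesis .
    qed
  qed
  have "\<bar>abel (\<beta> - 1) g t' - abel (\<beta> - 1) g t\<bar>
     = \<bar>LINT s|lborel. ?k (\<beta> - 1) t' s * g s - ?k (\<beta> - 1) t s * g s\<bar>"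
    unfolding ab by (subst Bochner_Integration.integral_diff[OF Ig(2,1)]) simp
  also have "\<dots> \<le> (LINT s|lborel. \<bar>?k (\<beta> - 1) t' s * g s - ?k (\<beta> - 1) t s * g s\<bar>)"
    by (rule integral_abs_bound)
  also have "\<dots> \<le> (LINT s|lborel. (t' - t) powr \<epsilon> * (?k (\<beta> - 1 - \<epsilon>) t s * h s + ?k (\<beta> - 1 - \<epsilon>) t' s * h s))"
    by (intro integral_mono integrable_abs Bochner_Integration.integrable_diff integrable_mult_right
        Bochner_Integration.integrable_add Ig Ih pw)
  also have "\<dots> = (t' - t) powr \<epsilon> * (abel (\<beta> - 1 - \<epsilon>) h t + abel (\<beta> - 1 - \<epsilon>) h t')"
    unfolding ab by (simp add: Bochner_Integration.integral_add[OF Ih])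
  finally show ?thesis .
qed

section \<open>A Volterra equation with a supersolution\<close>

text \<open>The growth of \<open>f\<close> enters only below the bound \<open>B\<close>: there \<open>f\<close> is dominated by \<open>h\<close>, and the integral operator
  applied to \<open>h\<close> gives back at most \<open>B\<close>.  Hence the functions below \<open>B\<close> are mapped to functions
  below \<open>B\<close>.\<close>

locale dominated_volterra =
  fixes \<beta> \<epsilon> x0 :: real and h B :: "real \<Rightarrow> real" and f :: "real \<Rightarrow> real \<Rightarrow> real"
  assumes \<beta>: "0 < \<beta>" "\<beta> < 1" and \<epsilon>: "0 < \<epsilon>" "\<epsilon> \<le> 1"
    and h_meas [measurable]: "h \<in> borel_measurable borel" and h_nonneg: "\<And>s. 0 < s \<Longrightarrow> 0 \<le> h s"
    and h_abel: "\<And>T. 0 < T \<Longrightarrow> \<exists>C. \<forall>t. 0 < t \<and> t \<le> T \<longrightarrow> abel_integrable (\<beta> - 1 - \<epsilon>) h t \<and>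
      t powr (1 - \<beta>) * abel (\<beta> - 1 - \<epsilon>) h t \<le> C"
    and B_mono: "\<And>s t. 0 < s \<Longrightarrow> s \<le> t \<Longrightarrow> B s \<le> B t"
    and supersolution: "\<And>t. 0 < t \<Longrightarrow> \<bar>x0\<bar> + t powr (1 - \<beta>) / Gamma \<beta> * abel (\<beta> - 1) h t \<le> B t"
    and f_cont: "continuous_on ({0<..} \<times> UNIV) (\<lambda>(t, x). f t x)"
    and f_dom: "\<And>s y. 0 < s \<Longrightarrow> \<bar>y\<bar> \<le> B s \<Longrightarrow> \<bar>f s (s powr (\<beta> - 1) * y)\<bar> \<le> h s"
begin

definition admissible :: "(real \<Rightarrow> real) \<Rightarrow> bool" where
  "admissible g \<longleftrightarrow> g \<in> borel_measurable borel \<and> (\<forall>s>0. \<bar>g s\<bar> \<le> h s)"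

text \<open>The right-hand side of the equation for \<open>y(t) = t\<^bsup>1-\<beta>\<^esup> x(t)\<close>.  As the integral vanishes for
  \<open>t \<le> 0\<close>, the value there is \<open>x0\<close>; this constant history is what the delayed equations below use.\<close>

definition weighted_integral :: "(real \<Rightarrow> real) \<Rightarrow> real \<Rightarrow> real" where
  "weighted_integral g t = x0 + t powr (1 - \<beta>) / Gamma \<beta> * abel (\<beta> - 1) g t"

text \<open>The density \<open>f(s, x(s))\<close> in terms of \<open>y\<close>, cut off outside \<open>(0, \<infinity>)\<close>, where \<open>f\<close> need not be
  measurable.\<close>

definition rhs :: "(real \<Rightarrow> real) \<Rightarrow> real \<Rightarrow> real" where
  "rhs u s = (if s > 0 then f s (s powr (\<beta> - 1) * u s) else 0)"

lemma Gamma_pos: "Gamma \<beta> > 0"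
  using \<beta> by simp

lemma h_integrable:
  assumes "0 < t"
  shows "abel_integrable (\<beta> - 1 - \<epsilon>) h t" "abel_integrable (\<beta> - 1) h t"
    "abel (\<beta> - 1) h t \<le> t powr \<epsilon> * abel (\<beta> - 1 - \<epsilon>) h t"
proof -
  show *: "abel_integrable (\<beta> - 1 - \<epsilon>) h t" using h_abel[OF assms] assms by blast
  from abel_integrable_weaken[OF * _ h_meas assms h_nonneg, of "\<beta> - 1"] \<epsilon>
  show "abel_integrable (\<beta> - 1) h t" "abel (\<beta> - 1) h t \<le> t powr \<epsilon> * abel (\<beta> - 1 - \<epsilon>) h t"
    by auto
qed

lemma abel_admissible:
  assumes "admissible g" "0 < t"
  shows "abel_integrable (\<beta> - 1) g t" "\<bar>abel (\<beta> - 1) g t\<bar> \<le> abel (\<beta> - 1) h t"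
  using abel_dominated[OF h_integrable(2)[OF assms(2)], of g] assms by (auto simp: admissible_def)

lemma weighted_integral_nonpos: "t \<le> 0 \<Longrightarrow> weighted_integral g t = x0"
  by (simp add: weighted_integral_def)

lemma weighted_integral_diff_x0:
  assumes "admissible g" "0 < t"
  shows "\<bar>weighted_integral g t - x0\<bar> \<le> t powr (1 - \<beta>) / Gamma \<beta> * abel (\<beta> - 1) h t"
proof -
  have "\<bar>weighted_integral g t - x0\<bar> = t powr (1 - \<beta>) / Gamma \<beta> * \<bar>abel (\<beta> - 1) g t\<bar>"
    using Gamma_pos by (simp add: weighted_integral_def abs_mult)
  also have "\<dots> \<le> t powr (1 - \<beta>) / Gamma \<beta> * abel (\<beta> - 1) h t"
    using abel_admissible(2)[OF assms] Gamma_pos by (intro mult_left_mono) auto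
  finally show ?thesis .
qed

lemma weighted_integral_le:
  assumes "admissible g" "0 < t"
  shows "\<bar>weighted_integral g t\<bar> \<le> B t"
  using weighted_integral_diff_x0[OF assms] supersolution[OF assms(2)] by linarith

lemma abs_x0_le: "0 < t \<Longrightarrow> \<bar>x0\<bar> \<le> B t"
  using supersolution[of t] abel_nonneg[of t h "\<beta> - 1"] h_nonneg Gamma_pos
  by (smt (verit, best) divide_nonneg_pos mult_nonneg_nonneg powr_ge_zero)

text \<open>The modulus of continuity \<open>\<phi>\<close> is the same for all admissible densities.\<close>

lemma weighted_integral_equicontinuous:
  assumes t0: "0 < t0"
  shows "\<exists>\<phi>. (\<phi> \<longlongrightarrow> 0) (nhds t0) \<and>
    (\<forall>\<^sub>F t in nhds t0. \<forall>g. admissible g \<longrightarrow> \<bar>weighted_integral g t - weighted_integral g t0\<bar> \<le> \<phi> t)"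
proof -
  let ?J = "abel (\<beta> - 1 - \<epsilon>) h"
  obtain C where C: "\<And>t. 0 < t \<Longrightarrow> t \<le> 2 * t0 \<Longrightarrow> t powr (1 - \<beta>) * ?J t \<le> C"
    using h_abel[of "2 * t0"] t0 by auto
  have J0: "?J t \<ge> 0" for t using h_nonneg by (intro abel_nonneg) auto
  \<comment> \<open>\<open>M\<close> bounds the more singular integral of \<open>h\<close> near \<open>t0\<close>, and \<open>N\<close> the integrals of the densities.\<close>
  define M where "M = (t0 / 2) powr (\<beta> - 1) * C"
  have J: "?J t \<le> M" if "t0 / 2 \<le> t" "t \<le> 2 * t0" for t
  proof -
    have t: "0 < t" using that t0 by simp
    have C0: "0 \<le> C" using C[of t] t that J0[of t] by (smt (verit) mult_nonneg_nonneg powr_ge_zero)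
    have "?J t = t powr (\<beta> - 1) * (t powr (1 - \<beta>) * ?J t)"
      using t by (simp add: mult.assoc[symmetric] powr_add[symmetric])
    also have "\<dots> \<le> t powr (\<beta> - 1) * C" using C[of t] t that by (intro mult_left_mono) auto
    also have "\<dots> \<le> M" unfolding M_def
      using that t0 \<beta> C0 by (intro mult_right_mono powr_mono2') auto
    finally show ?thesis .
  qed
  define N where "N = (2 * t0) powr \<epsilon> * M"
  define \<phi> where "\<phi> = (\<lambda>t. 1 / Gamma \<beta> * (\<bar>t powr (1 - \<beta>) - t0 powr (1 - \<beta>)\<bar> * N
    + t0 powr (1 - \<beta>) * (\<bar>t - t0\<bar> powr \<epsilon> * (2 * M))))"
  have "(\<phi> \<longlongrightarrow> 1 / Gamma \<beta> * (\<bar>t0 powr (1 - \<beta>) - t0 powr (1 - \<beta>)\<bar> * N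
    + t0 powr (1 - \<beta>) * (\<bar>t0 - t0\<bar> powr \<epsilon> * (2 * M)))) (nhds t0)"
    unfolding \<phi>_def using t0 \<epsilon> by (intro tendsto_intros filterlim_ident tendsto_powr') auto
  then have \<phi>: "(\<phi> \<longlongrightarrow> 0) (nhds t0)" by simp
  have "\<forall>\<^sub>F t in nhds t0. t \<in> {t0 / 2<..<2 * t0}"
    by (rule eventually_nhds_in_open) (use t0 in auto)
  then have "\<forall>\<^sub>F t in nhds t0. \<forall>g. admissible g \<longrightarrow>
      \<bar>weighted_integral g t - weighted_integral g t0\<bar> \<le> \<phi> t"
  proof eventually_elim
    case (elim t)
    show ?case
    proof (intro allI impI)
      fix g assume g: "admissible g"
      have t: "0 < t" "t0 / 2 \<le> t" "t \<le> 2 * t0" using elim t0 by auto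
      let ?I = "abel (\<beta> - 1) g"
      have I: "\<bar>?I t\<bar> \<le> N"
      proof -
        have "\<bar>?I t\<bar> \<le> t powr \<epsilon> * ?J t"
          using abel_admissible(2)[OF g t(1)] h_integrable(3)[OF t(1)] by linarith
        also have "\<dots> \<le> N" unfolding N_def
          using t t0 \<epsilon> J[of t] J0[of t] by (intro mult_mono powr_mono2) auto
        finally show ?thesis .
      qed
      have D: "\<bar>?I t - ?I t0\<bar> \<le> \<bar>t - t0\<bar> powr \<epsilon> * (2 * M)"
      proof -
        have *: "\<bar>?I b - ?I a\<bar> \<le> (b - a) powr \<epsilon> * (?J a + ?J b)" if "0 < a" "a < b" for a b
          using abel_diff_le[OF \<beta> \<epsilon> that h_meas h_nonneg h_integrable(1) h_integrable(1)] that g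
          by (simp add: admissible_def)
        have M: "?J t + ?J t0 \<le> 2 * M" using J[of t] J[of t0] t t0 by simp
        consider "t = t0" | "t < t0" | "t0 < t" by linarith
        then have "\<bar>?I t - ?I t0\<bar> \<le> \<bar>t - t0\<bar> powr \<epsilon> * (?J t + ?J t0)"
          using *[of t t0] *[of t0 t] t t0
          by cases (auto simp: abs_minus_commute add.commute)
        also have "\<dots> \<le> \<bar>t - t0\<bar> powr \<epsilon> * (2 * M)" using M by (intro mult_left_mono) auto
        finally show ?thesis .
      qed
      have "weighted_integral g t - weighted_integral g t0
        = 1 / Gamma \<beta> * ((t powr (1 - \<beta>) - t0 powr (1 - \<beta>)) * ?I t + t0 powr (1 - \<beta>) * (?I t - ?I t0))"
        using Gamma_pos by (simp add: weighted_integral_def field_simps)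
      also have "\<bar>\<dots>\<bar> = 1 / Gamma \<beta> *
          \<bar>(t powr (1 - \<beta>) - t0 powr (1 - \<beta>)) * ?I t + t0 powr (1 - \<beta>) * (?I t - ?I t0)\<bar>"
        using Gamma_pos by (simp add: abs_mult)
      also have "\<dots> \<le> 1 / Gamma \<beta> *
          (\<bar>t powr (1 - \<beta>) - t0 powr (1 - \<beta>)\<bar> * \<bar>?I t\<bar> + t0 powr (1 - \<beta>) * \<bar>?I t - ?I t0\<bar>)"
        using Gamma_pos abs_triangle_ineq[of "(t powr (1 - \<beta>) - t0 powr (1 - \<beta>)) * ?I t" "t0 powr (1 - \<beta>) * (?I t - ?I t0)"]
        by (intro mult_left_mono) (auto simp: abs_mult)
      also have "\<dots> \<le> \<phi> t" unfolding \<phi>_def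
        using Gamma_pos by (intro mult_left_mono add_mono I D) auto
      finally show "\<bar>weighted_integral g t - weighted_integral g t0\<bar> \<le> \<phi> t" .
    qed
  qed
  with \<phi> show ?thesis by blast
qed

lemma weighted_integral_tendsto:
  assumes "admissible g" "0 < t0"
  shows "(weighted_integral g \<longlongrightarrow> weighted_integral g t0) (nhds t0)"
proof -
  obtain \<phi> where \<phi>: "(\<phi> \<longlongrightarrow> 0) (nhds t0)"
    and *: "\<forall>\<^sub>F t in nhds t0. \<forall>g. admissible g \<longrightarrow> \<bar>weighted_integral g t - weighted_integral g t0\<bar> \<le> \<phi> t"
    using weighted_integral_equicontinuous[OF assms(2)] by blast
  from * have "\<forall>\<^sub>F t in nhds t0. norm (weighted_integral g t - weighted_integral g t0) \<le> \<phi> t"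
    by (rule eventually_mono) (simp add: assms(1))
  from Lim_null_comparison[OF this \<phi>]
  have "((\<lambda>t. weighted_integral g t - weighted_integral g t0) \<longlongrightarrow> 0) (nhds t0)" .
  then show ?thesis by (simp add: LIM_zero_iff)
qed

text \<open>The spare exponent leaves a factor \<open>t\<^sup>\<epsilon>\<close> in the estimate of the integral term.\<close>

lemma weighted_integral_tendsto_0:
  assumes "admissible g"
  shows "(weighted_integral g \<longlongrightarrow> x0) (at_right 0)"
proof -
  obtain C where C: "\<And>t. 0 < t \<Longrightarrow> t \<le> 1 \<Longrightarrow> t powr (1 - \<beta>) * abel (\<beta> - 1 - \<epsilon>) h t \<le> C"
    using h_abel[of 1] by auto
  have "\<forall>\<^sub>F t in at_right (0::real). 0 \<le> t"
    by (rule eventually_mono[OF eventually_at_right_less]) simp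
  then have "((\<lambda>t::real. t powr \<epsilon>) \<longlongrightarrow> 0 powr \<epsilon>) (at_right 0)"
    by (intro tendsto_powr'[OF tendsto_ident_at tendsto_const]) (simp add: \<epsilon>)
  from tendsto_mult[OF this tendsto_const[of "C / Gamma \<beta>"]]
  have 0: "((\<lambda>t. t powr \<epsilon> * C / Gamma \<beta>) \<longlongrightarrow> 0) (at_right 0)" by simp
  have "\<forall>\<^sub>F t in at_right 0. norm (weighted_integral g t - x0) \<le> t powr \<epsilon> * C / Gamma \<beta>"
    unfolding eventually_at_right_field
  proof (intro exI[of _ 1] conjI allI impI)
    fix t :: real assume t: "0 < t" "t < 1"
    have "norm (weighted_integral g t - x0) \<le> t powr (1 - \<beta>) / Gamma \<beta> * abel (\<beta> - 1) h t"
      using weighted_integral_diff_x0[OF assms t(1)] by simp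
    also have "\<dots> \<le> t powr (1 - \<beta>) / Gamma \<beta> * (t powr \<epsilon> * abel (\<beta> - 1 - \<epsilon>) h t)"
      using h_integrable(3)[OF t(1)] Gamma_pos by (intro mult_left_mono) auto
    also have "\<dots> = t powr \<epsilon> * (t powr (1 - \<beta>) * abel (\<beta> - 1 - \<epsilon>) h t) / Gamma \<beta>" by simp
    also have "\<dots> \<le> t powr \<epsilon> * C / Gamma \<beta>"
      using C[of t] t Gamma_pos by (intro divide_right_mono mult_left_mono) auto
    finally show "norm (weighted_integral g t - x0) \<le> t powr \<epsilon> * C / Gamma \<beta>" .
  qed simp
  from Lim_null_comparison[OF this 0]
  have "((\<lambda>t. weighted_integral g t - x0) \<longlongrightarrow> 0) (at_right 0)" .
  then show ?thesis by (simp add: LIM_zero_iff)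
qed

lemma weighted_integral_continuous:
  assumes "admissible g"
  shows "continuous_on UNIV (weighted_integral g)"
proof -
  have "isCont (weighted_integral g) t" for t
  proof -
    consider "t < 0" | "t = 0" | "t > 0" by linarith
    then show ?thesis
    proof cases
      case 1
      have "\<forall>\<^sub>F s in nhds t. s \<in> {..<0}" by (rule eventually_nhds_in_open) (use 1 in auto)
      then have "\<forall>\<^sub>F s in nhds t. weighted_integral g s = x0"
        by eventually_elim (simp add: weighted_integral_nonpos)
      then show ?thesis by (subst isCont_cong) auto
    next
      case 2
      have "\<forall>\<^sub>F s in at_left 0. x0 = weighted_integral g s"
        unfolding eventually_at_left_field by (auto simp: weighted_integral_nonpos intro!: exI[of _ "-1"])
      then have "(weighted_integral g \<longlongrightarrow> x0) (at_left 0)" by (rule Lim_transform_eventually[OF tendsto_const])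
      with weighted_integral_tendsto_0[OF assms] show ?thesis
        unfolding isCont_def 2 by (simp add: filterlim_split_at weighted_integral_nonpos)
    next
      case 3
      then show ?thesis
        using weighted_integral_tendsto[OF assms 3] by (simp add: isCont_def tendsto_at_iff_tendsto_nhds)
    qed
  qed
  then show ?thesis by (simp add: continuous_at_imp_continuous_on)
qed

lemma rhs_measurable:
  assumes [measurable]: "u \<in> borel_measurable borel"
  shows "rhs u \<in> borel_measurable borel"
proof -
  have "(\<lambda>z. indicator ({0<..} \<times> UNIV) z *\<^sub>R (\<lambda>(t, x). f t x) z) \<in> borel_measurable borel"
    by (rule borel_measurable_continuous_on_indicator) (auto intro!: f_cont borel_open open_Times)
  moreover have "(\<lambda>s::real. (s, s powr (\<beta> - 1) * u s)) \<in> borel \<rightarrow>\<^sub>M borel" by measurable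
  ultimately have "(\<lambda>s. (\<lambda>z. indicator ({0<..} \<times> UNIV) z *\<^sub>R (\<lambda>(t, x). f t x) z) (s, s powr (\<beta> - 1) * u s))
     \<in> borel_measurable borel" by (rule measurable_compose[rotated])
  also have "(\<lambda>s. (\<lambda>z. indicator ({0<..} \<times> UNIV) z *\<^sub>R (\<lambda>(t, x). f t x) z) (s, s powr (\<beta> - 1) * u s)) = rhs u"
    by (auto simp: rhs_def indicator_def fun_eq_iff)
  finally show ?thesis .
qed

lemma rhs_admissible:
  assumes "u \<in> borel_measurable borel" "\<And>s. 0 < s \<Longrightarrow> \<bar>u s\<bar> \<le> B s"
  shows "admissible (rhs u)"
  using rhs_measurable[OF assms(1)] f_dom assms(2) by (simp add: admissible_def rhs_def)

text \<open>Picard iterates for the equation in which \<open>y(s)\<close> is replaced by \<open>y(s - \<delta>)\<close> in the density.\<close>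

primrec delayed_iterate :: "real \<Rightarrow> nat \<Rightarrow> real \<Rightarrow> real" where
  "delayed_iterate \<delta> 0 = (\<lambda>_. x0)"
| "delayed_iterate \<delta> (Suc j) = weighted_integral (rhs (\<lambda>s. delayed_iterate \<delta> j (s - \<delta>)))"

lemma delayed_iterate_admissible:
  assumes "0 \<le> \<delta>"
  shows "admissible (rhs (\<lambda>s. delayed_iterate \<delta> j (s - \<delta>)))"
proof (induction j)
  case 0
  show ?case by (rule rhs_admissible) (auto simp: abs_x0_le)
next
  case (Suc j)
  let ?u = "delayed_iterate \<delta> (Suc j)"
  have "continuous_on UNIV ?u" using weighted_integral_continuous[OF Suc] by simp
  then have [measurable]: "?u \<in> borel_measurable borel" by (rule borel_measurable_continuous_onI)
  show ?case
  proof (rule rhs_admissible)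
    show "(\<lambda>s. ?u (s - \<delta>)) \<in> borel_measurable borel" by measurable
    fix s :: real assume s: "0 < s"
    show "\<bar>?u (s - \<delta>)\<bar> \<le> B s"
    proof (cases "s \<le> \<delta>")
      case True
      then show ?thesis using abs_x0_le[OF s] by (simp add: weighted_integral_nonpos)
    next
      case False
      then have "\<bar>?u (s - \<delta>)\<bar> \<le> B (s - \<delta>)" using weighted_integral_le[OF Suc] by simp
      also have "\<dots> \<le> B s" using False assms by (intro B_mono) auto
      finally show ?thesis .
    qed
  qed
qed

text \<open>Values on \<open>(-\<infinity>, j\<delta>]\<close> determine the density on \<open>(-\<infinity>, (j+1)\<delta>]\<close>, so each iteration settles one
  more interval of length \<open>\<delta>\<close>.\<close>

lemma delayed_iterate_stable:
  assumes "0 < \<delta>" "t \<le> real j * \<delta>"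
  shows "delayed_iterate \<delta> (Suc j) t = delayed_iterate \<delta> j t"
  using assms(2)
proof (induction j arbitrary: t)
  case 0
  then show ?case by (simp add: weighted_integral_nonpos)
next
  case (Suc j)
  have "rhs (\<lambda>s. delayed_iterate \<delta> (Suc j) (s - \<delta>)) s = rhs (\<lambda>s. delayed_iterate \<delta> j (s - \<delta>)) s"
    if "s < t" for s
  proof -
    have "s - \<delta> \<le> real j * \<delta>" using that Suc.prems by (simp add: algebra_simps)
    from Suc.IH[OF this] show ?thesis by (simp add: rhs_def)
  qed
  then have "abel (\<beta> - 1) (rhs (\<lambda>s. delayed_iterate \<delta> (Suc j) (s - \<delta>))) t
      = abel (\<beta> - 1) (rhs (\<lambda>s. delayed_iterate \<delta> j (s - \<delta>))) t"
    by (intro abel_cong) auto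
  then show ?case unfolding delayed_iterate.simps(2) weighted_integral_def by simp
qed

text \<open>A Peano-type existence result: the iterates with delay \<open>1/(n+1)\<close> solve the delayed equation on
  \<open>[0, n]\<close>, and a subsequence converges to a solution without delay.\<close>

lemma fixed_point_exists:
  obtains y where "admissible (rhs y)" "\<And>t. 0 < t \<Longrightarrow> y t = weighted_integral (rhs y) t"
proof -
  define \<delta> where "\<delta> n = 1 / real (Suc n)" for n
  have \<delta>: "\<delta> n > 0" for n by (simp add: \<delta>_def)
  \<comment> \<open>After \<open>(n+1)\<^sup>2\<close> iterations with delay \<open>1/(n+1)\<close> the iterates are settled on \<open>[0, n]\<close>.
    The predecessor of \<open>(n+1)\<^sup>2\<close> is written \<open>n + n * Suc n\<close>, so \<open>v n\<close> is the argument that \<open>u n\<close>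
    comes from, and it is a shift of \<open>u n\<close> itself where the iterates are settled.\<close>
  define u where "u n = delayed_iterate (\<delta> n) (Suc n * Suc n)" for n
  define v where "v n = (\<lambda>s. delayed_iterate (\<delta> n) (n + n * Suc n) (s - \<delta> n))" for n
  have u_eq: "u n = weighted_integral (rhs (v n))" for n
    by (simp add: u_def v_def)
  have v_adm: "admissible (rhs (v n))" for n
    unfolding v_def using \<delta>[of n] by (intro delayed_iterate_admissible) simp
  have v_u: "v n s = u n (s - \<delta> n)" if "s \<le> real n" for n s
  proof -
    have "real (n + n * Suc n) * \<delta> n = real n + real n * \<delta> n"
      by (simp add: \<delta>_def field_simps)
    then have "s - \<delta> n \<le> real (n + n * Suc n) * \<delta> n"
      using that \<delta>[of n] by (smt (verit) mult_nonneg_nonneg of_nat_0_le_iff)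
    from delayed_iterate_stable[OF \<delta> this] show ?thesis by (simp add: u_def v_def)
  qed
  have uB: "\<bar>u n t\<bar> \<le> B t" if "0 < t" for n t
    using weighted_integral_le[OF v_adm that] by (simp add: u_eq)

  \<comment> \<open>Dividing by \<open>B\<close> makes the sequence bounded uniformly on the unbounded set \<open>S\<close>.\<close>
  define S where "S = \<rat> \<inter> {0::real<..}"
  have "countable S" unfolding S_def by (intro countable_Int1 countable_rat)
  moreover have "norm (u n q / B q) \<le> 1" if "q \<in> S" for n q
  proof -
    have "\<bar>u n q\<bar> \<le> B q" using uB that by (simp add: S_def)
    then show ?thesis by (auto simp: divide_simps)
  qed
  ultimately obtain r :: "nat \<Rightarrow> nat" where r: "strict_mono r"
    and conv: "\<And>q. q \<in> S \<Longrightarrow> \<exists>l. (\<lambda>n. u (r n) q / B q) \<longlonglongrightarrow> l"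
    using function_convergent_subsequence[of S "\<lambda>n q. u n q / B q" 1] by blast
  have rat: "convergent (\<lambda>n. u (r n) q)" if q: "q \<in> S" for q
  proof -
    obtain l where "(\<lambda>n. u (r n) q / B q) \<longlonglongrightarrow> l" using conv[OF q] by blast
    then have "(\<lambda>n. u (r n) q / B q * B q) \<longlonglongrightarrow> l * B q" by (intro tendsto_intros)
    moreover have "u (r n) q / B q * B q = u (r n) q" for n
      using uB[of q "r n"] q by (cases "B q = 0") (auto simp: S_def)
    ultimately show ?thesis by (auto simp: convergent_def)
  qed
  have equi: "\<exists>\<phi>. (\<phi> \<longlongrightarrow> 0) (nhds t) \<and> (\<forall>\<^sub>F s in nhds t. \<forall>n. \<bar>u n s - u n t\<bar> \<le> \<phi> s)"
    if t: "0 < t" for t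
  proof -
    obtain \<phi> where "(\<phi> \<longlongrightarrow> 0) (nhds t)"
      and *: "\<forall>\<^sub>F s in nhds t. \<forall>g. admissible g \<longrightarrow> \<bar>weighted_integral g s - weighted_integral g t\<bar> \<le> \<phi> s"
      using weighted_integral_equicontinuous[OF t] by blast
    moreover from * have "\<forall>\<^sub>F s in nhds t. \<forall>n. \<bar>u n s - u n t\<bar> \<le> \<phi> s"
      unfolding u_eq by (rule eventually_mono) (use v_adm in blast)
    ultimately show ?thesis by (intro exI conjI)
  qed
  \<comment> \<open>Equicontinuity carries convergence from the rationals to every \<open>t > 0\<close>.\<close>
  have convt: "convergent (\<lambda>n. u (r n) t)" if t: "0 < t" for t
  proof -
    obtain \<phi> where \<phi>: "(\<phi> \<longlongrightarrow> 0) (nhds t)" "\<forall>\<^sub>F s in nhds t. \<forall>n. \<bar>u n s - u n t\<bar> \<le> \<phi> s"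
      using equi[OF t] by blast
    have "Cauchy (\<lambda>n. u (r n) t)"
    proof (rule metric_CauchyI)
      fix e :: real assume e: "0 < e"
      have "\<forall>\<^sub>F s in nhds t. \<phi> s < e / 3" by (rule order_tendstoD(2)[OF \<phi>(1)]) (use e in simp)
      moreover have "\<forall>\<^sub>F s in nhds t. s \<in> {0<..}" by (rule eventually_nhds_in_open) (use t in auto)
      ultimately have "\<forall>\<^sub>F s in nhds t. 0 < s \<and> (\<forall>n. \<bar>u n s - u n t\<bar> < e / 3)"
        using \<phi>(2) by eventually_elim (blast intro: le_less_trans)
      then obtain d where d: "d > 0" "\<And>s. dist s t < d \<Longrightarrow> 0 < s \<and> (\<forall>n. \<bar>u n s - u n t\<bar> < e / 3)"
        unfolding eventually_nhds_metric by blast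
      obtain q where q: "q \<in> \<rat>" "t < q" "q < t + d" using Rats_dense_in_real[of t "t + d"] d by auto
      then have qt: "dist q t < d" by (simp add: dist_real_def)
      with d(2) q have qS: "q \<in> S" by (auto simp: S_def)
      from rat[OF qS] have "Cauchy (\<lambda>n. u (r n) q)" by (rule convergent_Cauchy)
      then obtain N where N: "\<And>m n. N \<le> m \<Longrightarrow> N \<le> n \<Longrightarrow> dist (u (r m) q) (u (r n) q) < e / 3"
        using e metric_CauchyD[of "\<lambda>n. u (r n) q" "e / 3"] by auto
      have "dist (u (r m) t) (u (r n) t) < e" if "N \<le> m" "N \<le> n" for m n
      proof -
        have "\<bar>u (r m) q - u (r m) t\<bar> < e / 3" "\<bar>u (r n) q - u (r n) t\<bar> < e / 3"
          using d(2)[OF qt] by blast+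
        with N[OF that] show ?thesis unfolding dist_real_def by linarith
      qed
      then show "\<exists>N. \<forall>m\<ge>N. \<forall>n\<ge>N. dist (u (r m) t) (u (r n) t) < e" by blast
    qed
    then show ?thesis by (rule Cauchy_convergent)
  qed
  define y where "y t = (if t > 0 then lim (\<lambda>n. u (r n) t) else x0)" for t
  have uy: "(\<lambda>n. u (r n) t) \<longlonglongrightarrow> y t" if "0 < t" for t
    using convt[OF that] that by (simp add: y_def convergent_LIMSEQ_iff)
  have u0: "u n t = x0" if "t \<le> 0" for n t using that by (simp add: u_eq weighted_integral_nonpos)
  have uy': "(\<lambda>n. u (r n) t) \<longlonglongrightarrow> y t" for t
  proof (cases "0 < t")
    case False
    then show ?thesis using u0[of t] by (simp add: y_def)
  qed (rule uy)
  have [measurable]: "u n \<in> borel_measurable borel" for n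
    using weighted_integral_continuous[OF v_adm] by (simp add: u_eq borel_measurable_continuous_onI)
  have y_meas: "y \<in> borel_measurable borel"
    by (rule borel_measurable_LIMSEQ_real[OF uy']) simp
  have yB: "\<bar>y t\<bar> \<le> B t" if "0 < t" for t
    by (rule tendsto_upperbound[OF tendsto_rabs[OF uy[OF that]]]) (simp_all add: uB[OF that])
  have y_adm: "admissible (rhs y)" using y_meas yB by (rule rhs_admissible)
  \<comment> \<open>Equicontinuity at \<open>s\<close> also absorbs the vanishing delay.\<close>
  have vy: "(\<lambda>n. v (r n) s) \<longlonglongrightarrow> y s" if s: "0 < s" for s
  proof -
    obtain \<phi> where \<phi>: "(\<phi> \<longlongrightarrow> 0) (nhds s)" "\<forall>\<^sub>F t in nhds s. \<forall>n. \<bar>u n t - u n s\<bar> \<le> \<phi> t"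
      using equi[OF s] by blast
    have "(\<lambda>n. \<delta> (r n)) \<longlonglongrightarrow> 0"
      using LIMSEQ_subseq_LIMSEQ[OF LIMSEQ_inverse_real_of_nat r] by (simp add: \<delta>_def o_def inverse_eq_divide)
    from tendsto_diff[OF tendsto_const[of s] this]
    have sd: "filterlim (\<lambda>n. s - \<delta> (r n)) (nhds s) sequentially" by simp
    have *: "(\<lambda>n. \<phi> (s - \<delta> (r n))) \<longlonglongrightarrow> 0" by (rule filterlim_compose[OF \<phi>(1) sd])
    have "\<forall>\<^sub>F n in sequentially. norm (v (r n) s - u (r n) s) \<le> \<phi> (s - \<delta> (r n))"
    proof -
      have "\<forall>\<^sub>F n in sequentially. s \<le> real n"
        using filterlim_real_sequentially by (simp add: filterlim_at_top)
      then have "\<forall>\<^sub>F n in sequentially. s \<le> real (r n)"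
      proof eventually_elim
        case (elim n)
        then show ?case using seq_suble[OF r, of n] by linarith
      qed
      moreover have "\<forall>\<^sub>F n in sequentially. \<forall>m. \<bar>u m (s - \<delta> (r n)) - u m s\<bar> \<le> \<phi> (s - \<delta> (r n))"
        by (rule eventually_compose_filterlim[OF \<phi>(2) sd])
      ultimately show ?thesis by eventually_elim (simp add: v_u)
    qed
    from tendsto_add[OF Lim_null_comparison[OF this *] uy[OF s]] show ?thesis by simp
  qed
  have rhs_conv: "(\<lambda>n. rhs (v (r n)) s) \<longlonglongrightarrow> rhs y s" if s: "0 < s" for s
  proof -
    have "isCont (\<lambda>(t, x). f t x) (s, s powr (\<beta> - 1) * y s)"
      using f_cont by (rule continuous_on_interior) (use s in \<open>simp add: interior_open open_Times\<close>)
    then have "(\<lambda>n. (\<lambda>(t, x). f t x) (s, s powr (\<beta> - 1) * v (r n) s))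
        \<longlonglongrightarrow> (\<lambda>(t, x). f t x) (s, s powr (\<beta> - 1) * y s)"
      by (rule isCont_tendsto_compose) (intro tendsto_intros vy s)
    then show ?thesis using s by (simp add: rhs_def)
  qed
  have "y t = weighted_integral (rhs y) t" if t: "0 < t" for t
  proof -
    have "(\<lambda>n. abel (\<beta> - 1) (rhs (v (r n))) t) \<longlonglongrightarrow> abel (\<beta> - 1) (rhs y) t"
      by (rule abel_tendsto[OF h_integrable(2)[OF t]])
        (use v_adm y_adm rhs_conv in \<open>auto simp: admissible_def\<close>)
    then have "(\<lambda>n. u (r n) t) \<longlonglongrightarrow> weighted_integral (rhs y) t"
      unfolding u_eq weighted_integral_def by (intro tendsto_intros)
    then show ?thesis using uy[OF t] LIMSEQ_unique by blast
  qed
  with y_adm that show ?thesis by blast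
qed

end

section \<open>The semigroup property\<close>

lemma abel_measurable [measurable]:
  assumes [measurable]: "g \<in> borel_measurable borel"
  shows "abel c g \<in> borel_measurable borel"
proof -
  have "(\<lambda>(t, s). if 0 < s \<and> s < t then (t - s) powr c * g s else 0) \<in> borel_measurable (borel \<Otimes>\<^sub>M lborel)"
    by measurable
  then have "(\<lambda>t. LINT s|lborel. (if 0 < s \<and> s < t then (t - s) powr c * g s else 0)) \<in> borel_measurable borel"
    by (rule lborel.borel_measurable_lebesgue_integral)
  also have "(\<lambda>t. LINT s|lborel. (if 0 < s \<and> s < t then (t - s) powr c * g s else 0)) = abel c g"
    unfolding abel_def set_lebesgue_integral_def fun_eq_iff
    by (intro allI Bochner_Integration.integral_cong) (auto simp: indicator_def)
  finally show ?thesis .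
qed

text \<open>Exchange the order of integration over the triangle \<open>0 < r < s < t\<close>; the inner integral is a Beta
  integral.\<close>

lemma abel_abel:
  assumes a: "0 < a" and b: "0 < b" and g [measurable]: "g \<in> borel_measurable borel"
    and int: "abel_integrable (a + b - 1) g t"
  shows "abel_integrable (a - 1) (abel (b - 1) g) t"
    and "abel (a - 1) (abel (b - 1) g) t = Beta a b * abel (a + b - 1) g t"
proof -
  let ?F = "\<lambda>r s. if 0 < r \<and> r < s \<and> s < t then (t - s) powr (a - 1) * (s - r) powr (b - 1) * g r else 0"
  \<comment> \<open>The factor \<open>c\<close> is \<open>1\<close> for the iterated integral itself and \<open>sgn (g r)\<close> for that of the absolute value.\<close>
  have F_r: "has_bochner_integral lborel (\<lambda>s. c * ?F r s)
      (c * (Beta a b * (indicator {0<..<t} r *\<^sub>R ((t - r) powr (a + b - 1) * g r))))" for r and c :: real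
  proof (cases "0 < r \<and> r < t")
    case True
    then have "has_bochner_integral lborel
      (\<lambda>s. (c * g r) * (indicator {r<..<t} s * ((t - s) powr (a - 1) * (s - r) powr (b - 1))))
      ((c * g r) * ((t - r) powr (a + b - 1) * Beta a b))"
      by (intro has_bochner_integral_mult_right has_bochner_integral_beta a b) auto
    moreover have "(\<lambda>s. (c * g r) * (indicator {r<..<t} s * ((t - s) powr (a - 1) * (s - r) powr (b - 1))))
        = (\<lambda>s. c * ?F r s)"
      using True by (auto simp: fun_eq_iff indicator_def)
    ultimately show ?thesis using True by (simp add: mult_ac)
  next
    case False
    then have "(\<lambda>s. c * ?F r s) = (\<lambda>_. 0)" by (auto simp: fun_eq_iff)
    then show ?thesis using False by (auto simp: indicator_def has_bochner_integral_zero)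
  qed
  have F_abs: "\<bar>?F r s\<bar> = sgn (g r) * ?F r s" for r s
    by (auto simp: abs_mult abs_sgn[of "g r"])
  have abs_eq: "(LINT s|lborel. norm (?F r s)) = Beta a b * \<bar>indicator {0<..<t} r *\<^sub>R ((t - r) powr (a + b - 1) * g r)\<bar>" for r
    using F_r[of "sgn (g r)" r] unfolding real_norm_def F_abs
    by (simp add: has_bochner_integral_iff abs_mult abs_sgn[of "g r"] mult_ac)
  have F: "integrable (lborel \<Otimes>\<^sub>M lborel) (\<lambda>(r, s). ?F r s)"
  proof (rule lborel_pair.Fubini_integrable)
    show "(\<lambda>(r, s). ?F r s) \<in> borel_measurable (lborel \<Otimes>\<^sub>M lborel)" by measurable
    show "integrable lborel (\<lambda>r. LINT s|lborel. norm (case (r, s) of (r, s) \<Rightarrow> ?F r s))"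
      using int unfolding prod.case abs_eq set_integrable_def by (intro integrable_mult_right integrable_abs)
    show "AE r in lborel. integrable lborel (\<lambda>s. case (r, s) of (r, s) \<Rightarrow> ?F r s)"
      using F_r[of 1] by (simp add: has_bochner_integral_iff)
  qed
  have F_s: "(LINT r|lborel. ?F r s) = indicator {0<..<t} s *\<^sub>R ((t - s) powr (a - 1) * abel (b - 1) g s)" for s
  proof -
    have "(LINT r|lborel. ?F r s) = (LINT r|lborel. (indicator {0<..<t} s * (t - s) powr (a - 1)) *
        (indicator {0<..<s} r *\<^sub>R ((s - r) powr (b - 1) * g r)))"
      by (intro Bochner_Integration.integral_cong) (auto simp: indicator_def)
    also have "\<dots> = (indicator {0<..<t} s * (t - s) powr (a - 1)) * abel (b - 1) g s"
      by (simp add: abel_def set_lebesgue_integral_def)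
    finally show ?thesis by simp
  qed
  show "abel_integrable (a - 1) (abel (b - 1) g) t"
    using lborel_pair.integrable_snd[OF F] unfolding F_s set_integrable_def .
  have "abel (a - 1) (abel (b - 1) g) t = (LINT s|lborel. LINT r|lborel. ?F r s)"
    unfolding F_s by (simp add: abel_def set_lebesgue_integral_def)
  also have "\<dots> = (LINT r|lborel. LINT s|lborel. ?F r s)"
    by (rule lborel_pair.Fubini_integral[OF F])
  also have "\<dots> = Beta a b * abel (a + b - 1) g t"
    using F_r[of 1] by (simp add: has_bochner_integral_iff abel_def set_lebesgue_integral_def)
  finally show "abel (a - 1) (abel (b - 1) g) t = Beta a b * abel (a + b - 1) g t" .
qed

lemma set_integral_lebesgue_lborel:
  fixes g :: "real \<Rightarrow> real"
  assumes [measurable]: "g \<in> borel_measurable borel" and A: "A \<in> sets borel"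
  shows "set_integrable lebesgue A g \<longleftrightarrow> set_integrable lborel A g"
    and "(LINT s:A|lebesgue. g s) = (LINT s:A|lborel. g s)"
proof -
  have "(\<lambda>s. indicator A s *\<^sub>R g s) \<in> borel_measurable lborel"
    using set_borel_measurable_lborel[OF A assms(1)] by (simp add: set_borel_measurable_def)
  then show "set_integrable lebesgue A g \<longleftrightarrow> set_integrable lborel A g"
    and "(LINT s:A|lebesgue. g s) = (LINT s:A|lborel. g s)"
    by (simp_all add: set_integrable_def set_lebesgue_integral_def integrable_completion integral_completion)
qed

lemma RL_integral_eq_abel:
  assumes "\<rho> \<in> borel_measurable borel"
  shows "RL_integral \<alpha> \<rho> t = 1 / Gamma \<alpha> * abel (\<alpha> - 1) \<rho> t"
proof -
  have "(\<lambda>s. (t - s) powr (\<alpha> - 1) * \<rho> s) \<in> borel_measurable borel" using assms by measurable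
  then show ?thesis by (simp add: RL_integral_def abel_def set_integral_lebesgue_lborel)
qed

section \<open>Primitives on the half-line\<close>

lemma primitive_diff:
  fixes g :: "real \<Rightarrow> real"
  assumes int: "\<And>t. 0 < t \<Longrightarrow> set_integrable lborel {0<..<t} g" and ab: "0 < a" "a \<le> b"
  shows "g integrable_on {a..b}"
    and "(LINT s:{0<..<b}|lborel. g s) - (LINT s:{0<..<a}|lborel. g s) = integral {a..b} g"
proof -
  have *: "g integrable_on {0..t} \<and> (LINT s:{0<..<t}|lborel. g s) = integral {0..t} g" if "0 < t" for t
    using set_borel_integral_eq_integral[OF int[OF that]]
    by (simp add: integrable_on_Icc_iff_Ioo integral_open_interval_real)
  have b: "0 < b" using ab by simp
  show "g integrable_on {a..b}"
    using *[OF b] ab by (auto intro: integrable_on_subinterval)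
  show "(LINT s:{0<..<b}|lborel. g s) - (LINT s:{0<..<a}|lborel. g s) = integral {a..b} g"
    using *[OF b] *[OF ab(1)] Henstock_Kurzweil_Integration.integral_combine[of 0 a b g] ab by simp
qed

lemma primitive_has_derivative:
  fixes g F :: "real \<Rightarrow> real"
  assumes int: "\<And>t. 0 < t \<Longrightarrow> set_integrable lborel {0<..<t} g" and cont: "continuous_on {0<..} g"
    and F: "\<And>t. 0 < t \<Longrightarrow> F t = c + (LINT s:{0<..<t}|lborel. g s)" and t: "0 < t"
  shows "(F has_real_derivative g t) (at t)"
proof -
  let ?I = "{t / 2..2 * t}"
  have "((\<lambda>x. integral {t / 2..x} g) has_real_derivative g t) (at t within ?I)"
    by (rule integral_has_real_derivative) (use t cont in \<open>auto intro: continuous_on_subset\<close>)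
  then have "((\<lambda>x. F (t / 2) + integral {t / 2..x} g) has_real_derivative g t) (at t within ?I)"
    by (auto intro!: derivative_eq_intros)
  moreover have "at t within ?I = at t" using t by (intro at_within_interior) auto
  ultimately have D: "((\<lambda>x. F (t / 2) + integral {t / 2..x} g) has_real_derivative g t) (at t)" by simp
  have "\<forall>\<^sub>F x in nhds t. x \<in> {t / 2<..}" by (rule eventually_nhds_in_open) (use t in auto)
  then have "\<forall>\<^sub>F x in nhds t. F x = F (t / 2) + integral {t / 2..x} g"
  proof eventually_elim
    case (elim x)
    then show ?case using primitive_diff(2)[OF int, of "t / 2" x] F[of x] F[of "t / 2"] t by simp
  qed
  from DERIV_cong_ev[OF refl this refl] D show ?thesis by simp
qed

text \<open>Absolute continuity on the whole half-line, not only on bounded parts: \<open>|g|\<close> is the sum of its part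
  on \<open>(0, \<eta>)\<close>, whose total integral is small, and a bounded part, which is controlled by total length.\<close>

lemma primitive_absolutely_continuous:
  fixes g F :: "real \<Rightarrow> real"
  assumes int: "\<And>t. 0 < t \<Longrightarrow> set_integrable lborel {0<..<t} g" and cont: "continuous_on {0<..} g"
    and F: "\<And>t. 0 < t \<Longrightarrow> F t = c + (LINT s:{0<..<t}|lborel. g s)"
    and bound: "\<And>t. t \<ge> T0 \<Longrightarrow> \<bar>g t\<bar> \<le> M"
  shows "absolutely_continuous_on {0<..} F"
  unfolding absolutely_continuous_on_def
proof (intro allI impI)
  fix e :: real assume e: "0 < e"
  let ?G = "\<lambda>s. \<bar>g s\<bar>"
  have intG: "set_integrable lborel {0<..<t} ?G" if "0 < t" for t
    by (rule set_integrable_abs[OF int[OF that]])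
  have G01: "?G integrable_on {0..1}"
    using set_borel_integral_eq_integral(1)[OF intG[of 1]] by (simp add: integrable_on_Icc_iff_Ioo)
  obtain \<eta> where \<eta>: "0 < \<eta>" "integral {0..\<eta>} ?G < e / 2"
  proof -
    have "continuous_on {0..1} (\<lambda>x. integral {0..x} ?G)" by (rule indefinite_integral_continuous_1[OF G01])
    then obtain d where d: "d > 0" "\<And>x. x \<in> {0..1} \<Longrightarrow> dist x 0 < d \<Longrightarrow>
        dist (integral {0..x} ?G) (integral {0..0} ?G) < e / 2"
      unfolding continuous_on_iff using e by (metis atLeastAtMost_iff half_gt_zero order_refl zero_le_one)
    have "dist (integral {0..min 1 (d / 2)} ?G) (integral {0..0} ?G) < e / 2"
      by (rule d(2)) (use d(1) in \<open>auto simp: dist_real_def\<close>)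
    then show ?thesis using that[of "min 1 (d / 2)"] d(1) by (auto simp: dist_real_def)
  qed
  have "compact {\<eta>..max \<eta> T0}" by simp
  moreover have "continuous_on {\<eta>..max \<eta> T0} g" using cont \<eta> by (auto intro: continuous_on_subset)
  ultimately have "bounded (g ` {\<eta>..max \<eta> T0})" using compact_continuous_image compact_imp_bounded by blast
  then obtain M1 where M1: "\<And>s. s \<in> {\<eta>..max \<eta> T0} \<Longrightarrow> \<bar>g s\<bar> \<le> M1"
    unfolding bounded_iff by (metis imageI real_norm_def)
  define N where "N = max 1 (max M M1)"
  have N: "\<bar>g s\<bar> \<le> N" if "\<eta> \<le> s" for s
    using M1[of s] bound[of s] that unfolding N_def by (cases "s \<le> T0") auto
  define \<delta> where "\<delta> = e / (2 * N)"
  have N1: "N \<ge> 1" by (simp add: N_def)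
  have \<delta>: "\<delta> > 0" "N * \<delta> = e / 2" using e N1 by (simp_all add: \<delta>_def)
  let ?u = "\<lambda>s. indicator {0<..<\<eta>} s *\<^sub>R \<bar>g s\<bar>"
  have iu: "set_integrable lborel A ?u" if "A \<in> sets borel" for A
    using set_integrable_subset[of lborel UNIV ?u A] intG[OF \<eta>(1)] that by (simp add: set_integrable_def)
  have U: "integral UNIV ?u = integral {0..\<eta>} ?G"
  proof -
    have "integral UNIV ?u = integral UNIV (\<lambda>s. if s \<in> {0<..<\<eta>} then \<bar>g s\<bar> else 0)"
      by (rule Henstock_Kurzweil_Integration.integral_cong) (simp add: indicator_def)
    also have "\<dots> = integral {0<..<\<eta>} ?G" by (rule integral_restrict_UNIV)
    finally show ?thesis by (simp add: integral_open_interval_real)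
  qed
  show "\<exists>\<delta>>0. \<forall>\<D> T. \<D> division_of T \<and> T \<subseteq> {0<..} \<and> (\<Sum>J\<in>\<D>. Sup J - Inf J) < \<delta>
        \<longrightarrow> (\<Sum>J\<in>\<D>. \<bar>F (Sup J) - F (Inf J)\<bar>) < e"
  proof (intro exI[of _ \<delta>] conjI allI impI \<delta>(1))
    fix \<D> T assume *: "\<D> division_of T \<and> T \<subseteq> {0<..} \<and> (\<Sum>J\<in>\<D>. Sup J - Inf J) < \<delta>"
    then have D: "\<D> division_of T" and T: "T \<subseteq> {0<..}" and s: "(\<Sum>J\<in>\<D>. Sup J - Inf J) < \<delta>" by auto
    have J: "\<bar>F (Sup J) - F (Inf J)\<bar> \<le> integral J ?u + N * (Sup J - Inf J)" if J: "J \<in> \<D>" for J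
    proof -
      obtain a b where ab: "J = {a..b}" using division_ofD(4)[OF D J] by auto
      have le: "a \<le> b" using division_ofD(3)[OF D J] ab by auto
      have a0: "0 < a" using division_ofD(2)[OF D J] T ab le by auto
      have "F b - F a = integral {a..b} g"
        using primitive_diff(2)[OF int a0 le] F[of a] F[of b] a0 le by simp
      also have "\<bar>\<dots>\<bar> \<le> integral {a..b} (\<lambda>s. ?u s + N)"
      proof -
        have "norm (integral {a..b} g) \<le> integral {a..b} (\<lambda>s. ?u s + N)"
        proof (rule integral_norm_bound_integral)
          show "g integrable_on {a..b}" by (rule primitive_diff(1)[OF int a0 le])
          show "(\<lambda>s. ?u s + N) integrable_on {a..b}"
            using set_borel_integral_eq_integral(1)[OF iu[of "{a..b}"]]
            by (intro integrable_add) (auto simp: integrable_const_ivl)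
          show "norm (g s) \<le> ?u s + N" if "s \<in> {a..b}" for s
            using N[of s] N1 that a0 by (cases "s < \<eta>") auto
        qed
        then show ?thesis by simp
      qed
      also have "\<dots> = integral {a..b} ?u + N * (b - a)"
        using set_borel_integral_eq_integral(1)[OF iu[of "{a..b}"]] le
        by (subst integral_add) (auto simp: integrable_const_ivl)
      finally show ?thesis using ab le by simp
    qed
    have TB: "T \<in> sets borel"
    proof -
      have "compact (\<Union>\<D>)"
        using D by (intro compact_Union) (auto dest: division_ofD(1,4))
      then show ?thesis using division_ofD(6)[OF D] by (simp add: borel_compact)
    qed
    have iT: "?u integrable_on T" "?u integrable_on UNIV"
      using set_borel_integral_eq_integral(1)[OF iu] TB by auto
    have "(\<Sum>J\<in>\<D>. \<bar>F (Sup J) - F (Inf J)\<bar>) \<le> (\<Sum>J\<in>\<D>. integral J ?u + N * (Sup J - Inf J))"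
      by (intro sum_mono J)
    also have "\<dots> = integral T ?u + N * (\<Sum>J\<in>\<D>. Sup J - Inf J)"
      using integral_combine_division_topdown[OF iT(1) D] by (simp add: sum.distrib sum_distrib_left)
    also have "integral T ?u \<le> integral UNIV ?u"
      by (intro integral_subset_le iT) auto
    also have "\<dots> + N * (\<Sum>J\<in>\<D>. Sup J - Inf J) < e / 2 + N * \<delta>"
      using s N1 \<eta>(2) unfolding U by (intro add_strict_mono mult_strict_left_mono) auto
    also have "\<dots> = e" using \<delta>(2) by simp
    finally show "(\<Sum>J\<in>\<D>. \<bar>F (Sup J) - F (Inf J)\<bar>) < e" by simp
  qed
qed

section \<open>Densities that decay at infinity\<close>

text \<open>The integral of the majorant \<open>D s\<^bsup>-\<delta>\<^esup>\<close> over \<open>[T0, t)\<close> is enlarged to one over \<open>(0, t)\<close>, which is a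
  Beta integral.\<close>

lemma abel_tail_le:
  assumes \<beta>: "0 < \<beta>" and \<delta>: "\<delta> < 1" and T0: "0 < T0" "T0 < t"
    and h: "h \<in> borel_measurable borel" "\<And>s. 0 < s \<Longrightarrow> 0 \<le> h s" and int: "abel_integrable (\<beta> - 1) h t"
    and D: "0 \<le> D" "\<And>s. T0 \<le> s \<Longrightarrow> h s \<le> D * s powr (- \<delta>)"
  shows "abel (\<beta> - 1) h t \<le> (LINT s:{0<..<T0}|lborel. (t - s) powr (\<beta> - 1) * h s)
    + D * (t powr (\<beta> - \<delta>) * Beta \<beta> (1 - \<delta>))"
proof -
  let ?k = "\<lambda>s. (t - s) powr (\<beta> - 1)"
  have t: "0 < t" using T0 by simp
  have P: "abel_integrable (\<beta> - 1) (\<lambda>s. s powr (- \<delta>)) t"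
     "abel (\<beta> - 1) (\<lambda>s. s powr (- \<delta>)) t = t powr (\<beta> - \<delta>) * Beta \<beta> (1 - \<delta>)"
    using abel_powr[of \<beta> "1 - \<delta>" t] \<beta> \<delta> t by simp_all
  have I1: "set_integrable lborel {0<..<T0} (\<lambda>s. ?k s * h s)"
    by (rule set_integrable_subset[OF int]) (use T0 in auto)
  have "abel (\<beta> - 1) h t \<le> (LINT s|lborel. indicator {0<..<T0} s *\<^sub>R (?k s * h s)
      + D * (indicator {0<..<t} s *\<^sub>R (?k s * s powr (- \<delta>))))"
    unfolding abel_def set_lebesgue_integral_def
  proof (rule integral_mono)
    fix s :: real
    have "?k s * h s \<le> D * (?k s * s powr (- \<delta>))" if "T0 \<le> s"
      using mult_left_mono[OF D(2)[OF that], of "?k s"] by (simp add: mult_ac)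
    then show "indicator {0<..<t} s *\<^sub>R (?k s * h s) \<le> indicator {0<..<T0} s *\<^sub>R (?k s * h s)
      + D * (indicator {0<..<t} s *\<^sub>R (?k s * s powr (- \<delta>)))"
      using D(1) T0 by (auto simp: indicator_def)
  qed (use int P(1) I1 in \<open>auto simp: set_integrable_def\<close>)
  also have "\<dots> = (LINT s:{0<..<T0}|lborel. ?k s * h s) + D * abel (\<beta> - 1) (\<lambda>s. s powr (- \<delta>)) t"
    using P(1) I1 by (simp add: abel_def set_lebesgue_integral_def set_integrable_def)
  finally show ?thesis using P(2) by simp
qed

text \<open>The part over \<open>(0, T0)\<close> is \<open>O((t - T0)\<^bsup>\<beta>-1\<^esup>)\<close>, the tail is \<open>O(t\<^bsup>\<beta>-\<gamma>\<^esup>)\<close>.\<close>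

lemma abel_tendsto_0_at_top:
  assumes \<beta>: "0 < \<beta>" "\<beta> < \<gamma>" "\<gamma> < 1" and T0: "0 < T0"
    and h: "h \<in> borel_measurable borel" "\<And>s. 0 < s \<Longrightarrow> 0 \<le> h s"
    and int: "\<And>t. 0 < t \<Longrightarrow> abel_integrable (\<beta> - 1) h t"
    and D: "0 \<le> D" "\<And>s. T0 \<le> s \<Longrightarrow> h s \<le> D * s powr (- \<gamma>)"
  shows "(abel (\<beta> - 1) h \<longlongrightarrow> 0) at_top"
proof -
  let ?H = "LINT s:{0<..<T0}|lborel. h s"
  have hT: "set_integrable lborel {0<..<T0} h"
  proof (rule set_integrable_dominated(1))
    show "set_integrable lborel {0<..<T0} (\<lambda>s. T0 powr (1 - \<beta>) * ((T0 - s) powr (\<beta> - 1) * h s))"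
      by (intro set_integrable_mult_right int T0)
    fix s assume s: "s \<in> {0<..<T0}"
    have "1 = T0 powr (1 - \<beta>) * T0 powr (\<beta> - 1)" using T0 by (simp add: powr_add[symmetric])
    also have "\<dots> \<le> T0 powr (1 - \<beta>) * (T0 - s) powr (\<beta> - 1)"
      using s \<beta> by (intro mult_left_mono powr_mono2') auto
    finally have "1 * h s \<le> T0 powr (1 - \<beta>) * (T0 - s) powr (\<beta> - 1) * h s"
      using h(2)[of s] s by (intro mult_right_mono) auto
    then show "\<bar>h s\<bar> \<le> T0 powr (1 - \<beta>) * ((T0 - s) powr (\<beta> - 1) * h s)" using h(2)[of s] s by (simp add: mult_ac)
  qed (use h in auto)
  define \<phi> where "\<phi> = (\<lambda>t. (t - T0) powr (\<beta> - 1) * ?H + D * (t powr (\<beta> - \<gamma>) * Beta \<beta> (1 - \<gamma>)))"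
  have "LIM t at_top. t - T0 :> at_top"
    using filterlim_tendsto_add_at_top[OF tendsto_const[of "- T0"] filterlim_ident] by simp
  then have "((\<lambda>t. (t - T0) powr (\<beta> - 1)) \<longlongrightarrow> 0) at_top"
    by (intro tendsto_neg_powr) (use \<beta> in auto)
  moreover have "((\<lambda>t. t powr (\<beta> - \<gamma>)) \<longlongrightarrow> 0) at_top"
    by (intro tendsto_neg_powr filterlim_ident) (use \<beta> in auto)
  ultimately have "(\<phi> \<longlongrightarrow> 0 * ?H + D * (0 * Beta \<beta> (1 - \<gamma>))) at_top"
    unfolding \<phi>_def by (intro tendsto_intros)
  then have \<phi>: "(\<phi> \<longlongrightarrow> 0) at_top" by simp
  have "\<forall>\<^sub>F t in at_top. norm (abel (\<beta> - 1) h t) \<le> \<phi> t"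
    using eventually_gt_at_top[of T0]
  proof eventually_elim
    case (elim t)
    have t: "0 < t" using elim T0 by simp
    have "(LINT s:{0<..<T0}|lborel. (t - s) powr (\<beta> - 1) * h s) \<le> (LINT s:{0<..<T0}|lborel. (t - T0) powr (\<beta> - 1) * h s)"
    proof (rule set_integral_mono)
      show "set_integrable lborel {0<..<T0} (\<lambda>s. (t - s) powr (\<beta> - 1) * h s)"
        by (rule set_integrable_subset[OF int[OF t]]) (use elim in auto)
      show "(t - s) powr (\<beta> - 1) * h s \<le> (t - T0) powr (\<beta> - 1) * h s" if "s \<in> {0<..<T0}" for s
        using that elim \<beta> h(2)[of s] by (intro mult_right_mono powr_mono2') auto
    qed (intro set_integrable_mult_right hT)
    also have "\<dots> = (t - T0) powr (\<beta> - 1) * ?H" by simp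
    finally have "abel (\<beta> - 1) h t \<le> \<phi> t" unfolding \<phi>_def
      using abel_tail_le[OF \<beta>(1,3) T0 elim h int[OF t] D] by linarith
    moreover have "0 \<le> abel (\<beta> - 1) h t" using h(2) by (intro abel_nonneg) auto
    ultimately show ?case by simp
  qed
  from Lim_null_comparison[OF this \<phi>] show ?thesis .
qed

section \<open>A supersolution for linear growth\<close>

lemma exp_minus_le_powr:
  fixes v \<epsilon> :: real
  assumes "0 < v" "0 < \<epsilon>" "\<epsilon> \<le> 1"
  shows "exp (- v) \<le> v powr (- \<epsilon>)"
proof -
  have "v powr \<epsilon> \<le> exp v"
  proof (cases "v \<le> 1")
    case True
    then have "v powr \<epsilon> \<le> 1" using powr_le1[of \<epsilon> v] assms by simp
    also have "\<dots> \<le> exp v" using assms by simp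
    finally show ?thesis .
  next
    case False
    then have "v powr \<epsilon> \<le> v powr 1" using assms by (intro powr_mono) auto
    also have "v powr 1 \<le> exp v" using exp_ge_add_one_self[of v] assms(1) unfolding powr_one[OF less_imp_le[OF assms(1)]] by linarith
    finally show ?thesis .
  qed
  then have "inverse (exp v) \<le> inverse (v powr \<epsilon>)" using assms by (intro le_imp_inverse_le) auto
  then show ?thesis by (simp add: exp_minus powr_minus)
qed

text \<open>The two hypotheses on \<open>f\<close> have different roles.  The bound by \<open>w\<close> is a linear growth condition in
  the weighted variable and controls the singularity at \<open>0\<close>; the second is linear growth in \<open>x\<close>
  itself with a decaying coefficient.  For large times the first is too weak, since
  \<open>t\<^bsup>1-\<beta>\<^esup>\<close> times a coefficient of size \<open>t\<^bsup>-\<gamma>\<^esup>\<close> need not decay.\<close>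

lemma linear_growth_supersolution:
  fixes \<beta> \<epsilon> \<gamma> K x0 :: real and w :: "real \<Rightarrow> real" and f :: "real \<Rightarrow> real \<Rightarrow> real"
  assumes \<beta>: "0 < \<beta>" "\<beta> < \<gamma>" "\<gamma> < 1" and \<epsilon>: "0 < \<epsilon>" "\<epsilon> \<le> 1"
    and w [measurable]: "w \<in> borel_measurable borel" and w0: "\<And>s. 0 < s \<Longrightarrow> 0 \<le> w s"
    and w_abel: "\<And>T. 0 < T \<Longrightarrow> \<exists>C. \<forall>t. 0 < t \<and> t \<le> T \<longrightarrow> abel_integrable (\<beta> - 1 - \<epsilon>) w t \<and>
      t powr (1 - \<beta>) * abel (\<beta> - 1 - \<epsilon>) w t \<le> C"
    and K: "0 \<le> K"
    and f_w: "\<And>s x. 0 < s \<Longrightarrow> \<bar>f s x\<bar> \<le> w s * max 1 (s powr (1 - \<beta>) * \<bar>x\<bar>)"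
    and f_K: "\<And>s x. 1 \<le> s \<Longrightarrow> \<bar>f s x\<bar> \<le> K * s powr (- \<gamma>) * max 1 \<bar>x\<bar>"
    and f_cont: "continuous_on ({0<..} \<times> UNIV) (\<lambda>(t, x). f t x)"
  obtains h B T0 D where "dominated_volterra \<beta> \<epsilon> x0 h B f"
    and "1 \<le> T0" "0 \<le> D" "\<And>s. T0 \<le> s \<Longrightarrow> h s \<le> D * s powr (- \<gamma>)"
proof -
  have \<beta>1: "\<beta> < 1" using \<beta> by simp
  have G: "0 < Gamma \<beta>" by (rule Gamma_real_pos[OF \<beta>(1)])
  then have G0: "Gamma \<beta> \<noteq> 0" by linarith
  let ?Be = "Beta \<beta> (1 - \<beta>)"
  \<comment> \<open>Past \<open>T0\<close> the operator multiplies a bound on \<open>x\<close> by at most \<open>1/4\<close>.\<close>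
  have "((\<lambda>T. K * T powr (\<beta> - \<gamma>) * ?Be / Gamma \<beta>) \<longlongrightarrow> K * 0 * ?Be / Gamma \<beta>) at_top"
    by (intro tendsto_intros tendsto_neg_powr filterlim_ident) (use \<beta> in \<open>auto simp: G0\<close>)
  then have "\<forall>\<^sub>F T in at_top. K * T powr (\<beta> - \<gamma>) * ?Be / Gamma \<beta> < 1 / 4"
    by (rule order_tendstoD) simp
  then have "\<forall>\<^sub>F T in at_top. K * T powr (\<beta> - \<gamma>) * ?Be / Gamma \<beta> < 1 / 4 \<and> 1 \<le> T"
    using eventually_ge_at_top by (rule eventually_conj)
  then obtain T0 where T0: "K * T0 powr (\<beta> - \<gamma>) * ?Be / Gamma \<beta> < 1 / 4" "1 \<le> T0"
    using eventually_happens by fastforce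
  have T0p: "0 < T0" using T0 by simp
  obtain C where C: "\<And>t. 0 < t \<Longrightarrow> t \<le> T0 \<Longrightarrow> t powr (1 - \<beta>) * abel (\<beta> - 1 - \<epsilon>) w t \<le> C"
    using w_abel[OF T0p] by blast
  \<comment> \<open>On \<open>(0, T0]\<close> it multiplies the bound \<open>exp(\<kappa>t)\<close> on \<open>y\<close> by at most \<open>1/4\<close>.\<close>
  have "((\<lambda>l. l powr (- \<epsilon>) * C / Gamma \<beta>) \<longlongrightarrow> 0 * C / Gamma \<beta>) at_top"
    by (intro tendsto_intros tendsto_neg_powr filterlim_ident) (use \<epsilon> in \<open>auto simp: G0\<close>)
  then have "\<forall>\<^sub>F l in at_top. l powr (- \<epsilon>) * C / Gamma \<beta> < 1 / 4"
    by (rule order_tendstoD) simp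
  then have "\<forall>\<^sub>F l in at_top. l powr (- \<epsilon>) * C / Gamma \<beta> < 1 / 4 \<and> 1 \<le> l"
    using eventually_ge_at_top by (rule eventually_conj)
  then obtain \<kappa> where \<kappa>: "\<kappa> powr (- \<epsilon>) * C / Gamma \<beta> < 1 / 4" "1 \<le> \<kappa>"
    using eventually_happens by fastforce
  \<comment> \<open>The integral takes up at most half of \<open>B\<close>, and \<open>C0 / 2\<close> covers \<open>x0\<close>.  The unit makes \<open>B \<ge> 1\<close>,
    which disposes of the maximum in the growth condition.\<close>
  define C0 where "C0 = 1 + 2 * \<bar>x0\<bar>"
  have C0: "1 \<le> C0" "\<bar>x0\<bar> \<le> C0 / 2" by (simp_all add: C0_def)
  define B where "B t = C0 * exp (\<kappa> * min t T0) * max 1 (t / T0) powr (1 - \<beta>)" for t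
  \<comment> \<open>\<open>X\<close> is the constant bound on \<open>x\<close> after \<open>T0\<close>, so that \<open>B(t) = X t\<^bsup>1-\<beta>\<^esup>\<close> there.\<close>
  define X where "X = C0 * exp (\<kappa> * T0) * T0 powr (\<beta> - 1)"
  \<comment> \<open>The minimum keeps \<open>h \<le> B w\<close> everywhere, so that integrability is inherited from \<open>w\<close>.\<close>
  define h where "h s = (if s < T0 then B s * w s else min (B s * w s) (K * s powr (- \<gamma>) * X))" for s
  have B_early: "B t = C0 * exp (\<kappa> * t)" if "0 < t" "t \<le> T0" for t
    using that T0p by (simp add: B_def)
  have B_late: "B t = X * t powr (1 - \<beta>)" if "T0 \<le> t" for t
  proof -
    have "max 1 (t / T0) powr (1 - \<beta>) = t powr (1 - \<beta>) * T0 powr (\<beta> - 1)"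
      using that T0p powr_minus_divide[of T0 "1 - \<beta>"] by (simp add: powr_divide max_def)
    then show ?thesis using that by (simp add: B_def X_def min_def)
  qed
  have B_mono: "B s \<le> B t" if "0 < s" "s \<le> t" for s t
    unfolding B_def using that T0p C0 \<kappa> \<beta>1
    by (intro mult_mono powr_mono2) (auto simp: divide_right_mono le_max_iff_disj intro: min.mono max.mono)
  have C0B: "C0 \<le> B t" if "0 < t" for t
  proof -
    have "C0 * 1 * 1 powr (1 - \<beta>) \<le> B t" unfolding B_def
      using that T0p C0 \<kappa> \<beta>1 by (intro mult_mono powr_mono2) (auto simp: min_def)
    then show ?thesis by simp
  qed
  have B1: "1 \<le> B t" if "0 < t" for t
    using C0B[OF that] C0(1) by linarith
  have X1: "1 \<le> X"
  proof -
    have "T0 powr (1 - \<beta>) \<le> T0 powr 1" using T0 \<beta> by (intro powr_mono) auto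
    also have "\<dots> \<le> \<kappa> * T0" using T0p \<kappa> by simp
    also have "\<dots> \<le> exp (\<kappa> * T0)" using exp_ge_add_one_self[of "\<kappa> * T0"] by linarith
    also have "\<dots> \<le> C0 * exp (\<kappa> * T0)" using C0 by simp
    finally have "T0 powr (1 - \<beta>) * T0 powr (\<beta> - 1) \<le> C0 * exp (\<kappa> * T0) * T0 powr (\<beta> - 1)"
      by (intro mult_right_mono) auto
    then show ?thesis using T0p by (simp add: X_def powr_add[symmetric])
  qed
  have B_meas [measurable]: "B \<in> borel_measurable borel" unfolding B_def by measurable
  have h_meas [measurable]: "h \<in> borel_measurable borel" unfolding h_def by measurable
  have h0: "0 \<le> h s" if "0 < s" for s
    using w0[OF that] B1[OF that] K X1 by (simp add: h_def)
  have h_le: "h s \<le> B s * w s" for s by (simp add: h_def)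
  have h_tail: "h s \<le> K * X * s powr (- \<gamma>)" if "T0 \<le> s" for s
    using that by (simp add: h_def mult_ac)
  have h_dom: "\<bar>h s\<bar> \<le> B t * w s" if "0 < s" "s < t" for s t
  proof -
    have "B s * w s \<le> B t * w s" using B_mono[of s t] w0[of s] that by (intro mult_right_mono) auto
    then show ?thesis using h_le[of s] h0[of s] that by linarith
  qed
  have h_abel: "\<exists>C. \<forall>t. 0 < t \<and> t \<le> T \<longrightarrow> abel_integrable (\<beta> - 1 - \<epsilon>) h t \<and>
      t powr (1 - \<beta>) * abel (\<beta> - 1 - \<epsilon>) h t \<le> C" if T: "0 < T" for T
  proof -
    obtain C1 where C1: "\<And>t. 0 < t \<Longrightarrow> t \<le> T \<Longrightarrow> abel_integrable (\<beta> - 1 - \<epsilon>) w t \<and>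
      t powr (1 - \<beta>) * abel (\<beta> - 1 - \<epsilon>) w t \<le> C1" using w_abel[OF T] by blast
    have "abel_integrable (\<beta> - 1 - \<epsilon>) h t \<and> t powr (1 - \<beta>) * abel (\<beta> - 1 - \<epsilon>) h t \<le> B T * C1"
      if t: "0 < t" "t \<le> T" for t
    proof -
      have int: "abel_integrable (\<beta> - 1 - \<epsilon>) (\<lambda>s. B T * w s) t"
        using set_integrable_mult_right[of "B T", OF conjunct1[OF C1[OF t]]] by (simp add: mult.left_commute)
      have dom: "\<bar>h s\<bar> \<le> B T * w s" if "0 < s" "s < t" for s
        using h_dom[of s T] that t by simp
      have "abel (\<beta> - 1 - \<epsilon>) h t \<le> abel (\<beta> - 1 - \<epsilon>) (\<lambda>s. B T * w s) t"
        using abel_dominated(2)[OF int h_meas dom] by linarith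
      also have "\<dots> = B T * abel (\<beta> - 1 - \<epsilon>) w t"
        by (simp add: abel_def mult.left_commute)
      finally have "t powr (1 - \<beta>) * abel (\<beta> - 1 - \<epsilon>) h t
          \<le> t powr (1 - \<beta>) * (B T * abel (\<beta> - 1 - \<epsilon>) w t)"
        by (rule mult_left_mono) simp
      also have "\<dots> = B T * (t powr (1 - \<beta>) * abel (\<beta> - 1 - \<epsilon>) w t)" by simp
      also have "\<dots> \<le> B T * C1" using C1[OF t] B1[OF T] by (intro mult_left_mono) auto
      finally show ?thesis using abel_dominated(1)[OF int h_meas dom] by blast
    qed
    then show ?thesis by blast
  qed
  have h_int: "abel_integrable (\<beta> - 1) h t" if t: "0 < t" for t
    using abel_integrable_weaken(1)[OF _ _ h_meas t h0] h_abel[OF t] \<epsilon> t by fastforce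
  \<comment> \<open>Here \<open>exp(\<kappa>s) = exp(\<kappa>t) exp(-\<kappa>(t-s)) \<le> exp(\<kappa>t) (\<kappa>(t-s))\<^bsup>-\<epsilon>\<^esup>\<close> trades the exponential for the
    more singular kernel and a small factor \<open>\<kappa>\<^bsup>-\<epsilon>\<^esup>\<close>.\<close>
  have early: "t powr (1 - \<beta>) / Gamma \<beta> * abel (\<beta> - 1) h t \<le> C0 * exp (\<kappa> * t) / 4"
    if t: "0 < t" "t \<le> T0" for t
  proof -
    let ?c = "C0 * exp (\<kappa> * t) * \<kappa> powr (- \<epsilon>)"
    have wint: "abel_integrable (\<beta> - 1 - \<epsilon>) w t" using w_abel[OF t(1)] t by blast
    have "abel (\<beta> - 1) h t \<le> (LINT s:{0<..<t}|lborel. ?c * ((t - s) powr (\<beta> - 1 - \<epsilon>) * w s))"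
      unfolding abel_def
    proof (rule set_integral_mono)
      show "set_integrable lborel {0<..<t} (\<lambda>s. ?c * ((t - s) powr (\<beta> - 1 - \<epsilon>) * w s))"
        by (rule set_integrable_mult_right[OF wint])
      fix s assume "s \<in> {0<..<t}"
      then have s: "0 < s" "s < t" by auto
      have "exp (\<kappa> * s) = exp (\<kappa> * t) * exp (- (\<kappa> * (t - s)))"
        by (simp add: exp_add[symmetric] algebra_simps)
      also have "\<dots> \<le> exp (\<kappa> * t) * (\<kappa> * (t - s)) powr (- \<epsilon>)"
        using s \<kappa> \<epsilon> by (intro mult_left_mono exp_minus_le_powr) auto
      also have "(\<kappa> * (t - s)) powr (- \<epsilon>) = \<kappa> powr (- \<epsilon>) * (t - s) powr (- \<epsilon>)"
        using s \<kappa> by (simp add: powr_mult)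
      finally have e: "exp (\<kappa> * s) \<le> exp (\<kappa> * t) * (\<kappa> powr (- \<epsilon>) * (t - s) powr (- \<epsilon>))" .
      have "(t - s) powr (\<beta> - 1) * h s \<le> (t - s) powr (\<beta> - 1) * (C0 * exp (\<kappa> * s) * w s)"
        using h_le[of s] B_early[of s] s t by (intro mult_left_mono) auto
      also have "\<dots> = ((t - s) powr (\<beta> - 1) * C0 * w s) * exp (\<kappa> * s)" by simp
      also have "\<dots> \<le> ((t - s) powr (\<beta> - 1) * C0 * w s) *
          (exp (\<kappa> * t) * (\<kappa> powr (- \<epsilon>) * (t - s) powr (- \<epsilon>)))"
        using e C0 w0[OF s(1)] by (intro mult_left_mono) auto
      also have "\<dots> = ?c * (((t - s) powr (\<beta> - 1) * (t - s) powr (- \<epsilon>)) * w s)" by simp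
      also have "(t - s) powr (\<beta> - 1) * (t - s) powr (- \<epsilon>) = (t - s) powr (\<beta> - 1 - \<epsilon>)"
        by (simp add: powr_add[symmetric])
      finally show "(t - s) powr (\<beta> - 1) * h s \<le> ?c * ((t - s) powr (\<beta> - 1 - \<epsilon>) * w s)" .
    qed (use h_int[OF t(1)] in auto)
    also have "\<dots> = ?c * abel (\<beta> - 1 - \<epsilon>) w t"
      by (simp add: abel_def)
    finally have "t powr (1 - \<beta>) / Gamma \<beta> * abel (\<beta> - 1) h t
        \<le> t powr (1 - \<beta>) / Gamma \<beta> * (?c * abel (\<beta> - 1 - \<epsilon>) w t)"
      using G by (intro mult_left_mono) auto
    also have "\<dots> = ?c / Gamma \<beta> * (t powr (1 - \<beta>) * abel (\<beta> - 1 - \<epsilon>) w t)" by simp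
    also have "\<dots> \<le> ?c / Gamma \<beta> * C"
      using C[OF t] C0 G by (intro mult_left_mono) auto
    also have "\<dots> = C0 * exp (\<kappa> * t) * (\<kappa> powr (- \<epsilon>) * C / Gamma \<beta>)" by simp
    also have "\<dots> \<le> C0 * exp (\<kappa> * t) * (1 / 4)"
      using \<kappa>(1) C0 by (intro mult_left_mono) auto
    finally show ?thesis by simp
  qed
  \<comment> \<open>After \<open>T0\<close> the history on \<open>(0, T0)\<close> contributes no more than it did at time \<open>T0\<close>, because the
    kernel decreases in \<open>t\<close>.\<close>
  have late: "t powr (1 - \<beta>) / Gamma \<beta> * abel (\<beta> - 1) h t \<le> B t / 2" if t: "T0 < t" for t
  proof -
    have tp: "0 < t" using t T0p by simp
    let ?D = "K * X * T0 powr (\<beta> - \<gamma>)"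
    have tail: "h s \<le> ?D * s powr (- \<beta>)" if s: "T0 \<le> s" for s
    proof -
      have "s powr (- \<gamma>) = s powr (\<beta> - \<gamma>) * s powr (- \<beta>)" by (simp add: powr_add[symmetric])
      also have "\<dots> \<le> T0 powr (\<beta> - \<gamma>) * s powr (- \<beta>)"
        using s T0p \<beta> by (intro mult_right_mono powr_mono2') auto
      finally have "K * X * s powr (- \<gamma>) \<le> K * X * (T0 powr (\<beta> - \<gamma>) * s powr (- \<beta>))"
        using K X1 by (intro mult_left_mono) auto
      then show ?thesis using h_tail[OF s] by (simp add: mult_ac)
    qed
    have "abel (\<beta> - 1) h t \<le> (LINT s:{0<..<T0}|lborel. (t - s) powr (\<beta> - 1) * h s)
        + ?D * (t powr (\<beta> - \<beta>) * ?Be)"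
      by (rule abel_tail_le[OF \<beta>(1) \<beta>1 T0p t h_meas h0 h_int[OF tp] _ tail]) (use K X1 in auto)
    also have "(LINT s:{0<..<T0}|lborel. (t - s) powr (\<beta> - 1) * h s) \<le> abel (\<beta> - 1) h T0"
      unfolding abel_def
    proof (rule set_integral_mono)
      show "set_integrable lborel {0<..<T0} (\<lambda>s. (t - s) powr (\<beta> - 1) * h s)"
        by (rule set_integrable_subset[OF h_int[OF tp]]) (use t in auto)
      show "(t - s) powr (\<beta> - 1) * h s \<le> (T0 - s) powr (\<beta> - 1) * h s" if "s \<in> {0<..<T0}" for s
        using that t \<beta>1 h0[of s] by (intro mult_right_mono powr_mono2') auto
    qed (rule h_int[OF T0p])
    also have "abel (\<beta> - 1) h T0 \<le> X * Gamma \<beta> / 4"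
    proof -
      have "abel (\<beta> - 1) h T0 = T0 powr (\<beta> - 1) * Gamma \<beta> * (T0 powr (1 - \<beta>) / Gamma \<beta> * abel (\<beta> - 1) h T0)"
        using G T0p powr_add[of T0 "\<beta> - 1" "1 - \<beta>"] by simp
      also have "\<dots> \<le> T0 powr (\<beta> - 1) * Gamma \<beta> * (C0 * exp (\<kappa> * T0) / 4)"
        using early[OF T0p order_refl] G by (intro mult_left_mono) auto
      finally show ?thesis by (simp add: X_def mult_ac)
    qed
    also have "?D * (t powr (\<beta> - \<beta>) * ?Be) = X * Gamma \<beta> * (K * T0 powr (\<beta> - \<gamma>) * ?Be / Gamma \<beta>)"
      using G tp by simp
    also have "\<dots> \<le> X * Gamma \<beta> * (1 / 4)"
      using T0(1) X1 G by (intro mult_left_mono) auto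
    finally have "abel (\<beta> - 1) h t \<le> X * Gamma \<beta> / 2" by simp
    then have "t powr (1 - \<beta>) / Gamma \<beta> * abel (\<beta> - 1) h t \<le> t powr (1 - \<beta>) / Gamma \<beta> * (X * Gamma \<beta> / 2)"
      using G by (intro mult_left_mono) auto
    then show ?thesis using G t by (simp add: B_late mult_ac)
  qed
  have "dominated_volterra \<beta> \<epsilon> x0 h B f"
  proof
    show "\<bar>x0\<bar> + t powr (1 - \<beta>) / Gamma \<beta> * abel (\<beta> - 1) h t \<le> B t" if t: "0 < t" for t
    proof (cases "t \<le> T0")
      case True
      then show ?thesis using early[OF t True] B_early[OF t True] C0(2) C0B[OF t] by linarith
    next
      case False
      then show ?thesis using late[of t] C0(2) C0B[OF t] by linarith
    qed
    show "\<bar>f s (s powr (\<beta> - 1) * y)\<bar> \<le> h s" if s: "0 < s" and y: "\<bar>y\<bar> \<le> B s" for s y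
    proof -
      let ?x = "s powr (\<beta> - 1) * y"
      have "s powr (1 - \<beta>) * \<bar>?x\<bar> = \<bar>y\<bar>"
        using s by (simp add: abs_mult mult.assoc[symmetric] powr_add[symmetric])
      then have "\<bar>f s ?x\<bar> \<le> w s * max 1 \<bar>y\<bar>" using f_w[OF s, of ?x] by simp
      also have "\<dots> \<le> w s * B s" using w0[OF s] y B1[OF s] by (intro mult_left_mono) auto
      finally have 1: "\<bar>f s ?x\<bar> \<le> B s * w s" by (simp add: mult.commute)
      have 2: "\<bar>f s ?x\<bar> \<le> K * s powr (- \<gamma>) * X" if s': "T0 \<le> s"
      proof -
        have "\<bar>?x\<bar> \<le> s powr (\<beta> - 1) * (X * s powr (1 - \<beta>))"
          using y B_late[OF s'] by (simp add: abs_mult mult_left_mono)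
        also have "\<dots> = X" using s powr_add[of s "\<beta> - 1" "1 - \<beta>"] by simp
        finally have "max 1 \<bar>?x\<bar> \<le> X" using X1 by simp
        then have "K * s powr (- \<gamma>) * max 1 \<bar>?x\<bar> \<le> K * s powr (- \<gamma>) * X"
          using K by (intro mult_left_mono) auto
        then show ?thesis using f_K[of s ?x] s' T0 by simp
      qed
      show ?thesis using 1 2 by (simp add: h_def)
    qed
  qed (use \<beta> \<beta>1 \<epsilon> h_meas h0 h_abel B_mono f_cont in auto)
  then show thesis using that[of h B T0 "K * X"] T0 K X1 h_tail by simp
qed

section \<open>From the Volterra equation to the differential equation\<close>

lemma abel_weight_bound_Lp_loc:
  fixes \<beta> \<epsilon> p T :: real and m :: "real \<Rightarrow> real"
  assumes \<beta>: "0 < \<beta>" "\<beta> < 1" and p: "p > 1 / \<beta>" and \<epsilon>: "0 < \<epsilon>" "\<epsilon> < \<beta> - 1 / p"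
    and cont: "continuous_on {0<..} m" and m0: "\<forall>t>0. 0 \<le> m t" and Lp: "m \<in> Lp_loc p"
  defines "m' \<equiv> \<lambda>s. indicator {0<..} s *\<^sub>R m s"
  shows "m' \<in> borel_measurable borel" and "0 < T \<Longrightarrow> \<exists>C. \<forall>t. 0 < t \<and> t \<le> T \<longrightarrow>
    abel_integrable (\<beta> - 1 - \<epsilon>) (\<lambda>s. s powr (\<beta> - 1) * m' s) t \<and>
    t powr (1 - \<beta>) * abel (\<beta> - 1 - \<epsilon>) (\<lambda>s. s powr (\<beta> - 1) * m' s) t \<le> C"
proof -
  show meas [measurable]: "m' \<in> borel_measurable borel"
    unfolding m'_def using cont by (intro borel_measurable_continuous_on_indicator) auto
  have pos: "0 \<le> m' s" for s using m0 by (auto simp: m'_def indicator_def)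
  show "\<exists>C. \<forall>t. 0 < t \<and> t \<le> T \<longrightarrow>
    abel_integrable (\<beta> - 1 - \<epsilon>) (\<lambda>s. s powr (\<beta> - 1) * m' s) t \<and>
    t powr (1 - \<beta>) * abel (\<beta> - 1 - \<epsilon>) (\<lambda>s. s powr (\<beta> - 1) * m' s) t \<le> C" if T: "0 < T"
  proof (rule abel_weight_bound[OF \<beta> p \<epsilon> meas pos _ T])
    have "is_interval {0<..T}" "bounded {0<..T}" "{0<..T} \<subseteq> {0..}"
      by (auto simp: is_interval_oc)
    then have "set_integrable lebesgue {0<..T} (\<lambda>t. \<bar>m t\<bar> powr p)"
      using Lp unfolding Lp_loc_def by blast
    also have "?this \<longleftrightarrow> set_integrable lebesgue {0<..T} (\<lambda>s. m' s powr p)"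
      using m0 by (intro set_integrable_cong) (auto simp: m'_def)
    finally show "set_integrable lborel {0<..T} (\<lambda>s. m' s powr p)"
      by (subst (asm) set_integral_lebesgue_lborel(1)) auto
  qed
qed

lemma abs_pow_le_max: "0 \<le> \<mu> \<Longrightarrow> \<mu> \<le> 1 \<Longrightarrow> abs_pow x \<mu> \<le> max 1 \<bar>x\<bar>"
proof -
  assume \<mu>: "0 \<le> \<mu>" "\<mu> \<le> 1"
  show ?thesis
  proof (cases "\<bar>x\<bar> \<le> 1")
    case True
    then show ?thesis using \<mu> by (auto simp: abs_pow_def powr_le1)
  next
    case False
    then have "\<bar>x\<bar> powr \<mu> \<le> \<bar>x\<bar> powr 1" using \<mu> by (intro powr_mono) auto
    then show ?thesis using False by (auto simp: abs_pow_def)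
  qed
qed

lemma abs_pow_scale:
  assumes "0 < s"
  shows "abs_pow x \<mu> = s powr (- (\<mu> * a)) * abs_pow (s powr a * x) \<mu>"
proof (cases "\<mu> = 0")
  case False
  have "\<bar>s powr a * x\<bar> powr \<mu> = s powr (\<mu> * a) * \<bar>x\<bar> powr \<mu>"
    by (simp add: abs_mult powr_mult powr_powr mult.commute)
  moreover have "s powr (- (\<mu> * a)) * s powr (\<mu> * a) = 1"
    using assms by (simp add: powr_add[symmetric])
  ultimately show ?thesis using False by (simp add: abs_pow_def mult.assoc[symmetric])
qed (use assms in \<open>simp add: abs_pow_def\<close>)

context dominated_volterra
begin

text \<open>\<open>x\<close> is defined through the integral rather than as \<open>t\<^bsup>\<beta>-1\<^esup> y(t)\<close>: the two agree for \<open>t > 0\<close>, but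
  only the former is known to be continuous up to \<open>0\<close>.\<close>

lemma solution_of_fixed_point:
  assumes y: "admissible (rhs y)" "\<And>t. 0 < t \<Longrightarrow> y t = weighted_integral (rhs y) t"
    and T0: "0 < T0" "0 \<le> D" "\<And>s. T0 \<le> s \<Longrightarrow> h s \<le> D * s powr (- \<gamma>)" and \<gamma>: "\<beta> < \<gamma>" "\<gamma> < 1"
  defines "x \<equiv> \<lambda>t. t powr (\<beta> - 1) * weighted_integral (rhs y) t"
  shows "x \<in> C_weighted (1 - \<beta>)" and "RL_solution \<beta> f x0 x" and "(x \<longlongrightarrow> 0) at_top"
proof -
  let ?g = "rhs y"
  let ?A = "weighted_integral ?g"
  have G: "0 < Gamma \<beta>" "0 < Gamma (1 - \<beta>)" using \<beta> by auto
  have g [measurable]: "?g \<in> borel_measurable borel" and gh: "\<And>s. 0 < s \<Longrightarrow> \<bar>?g s\<bar> \<le> h s"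
    using y(1) by (auto simp: admissible_def)
  have A_cont: "continuous_on UNIV ?A" by (rule weighted_integral_continuous[OF y(1)])
  have [measurable]: "?A \<in> borel_measurable borel" using A_cont by (rule borel_measurable_continuous_onI)
  have x_meas [measurable]: "x \<in> borel_measurable borel" unfolding x_def by measurable
  have A_eq: "t powr (1 - \<beta>) * x t = ?A t" if "0 < t" for t
    using that by (simp add: x_def mult.assoc[symmetric] powr_add[symmetric])
  have x_eq: "x t = x0 * t powr (\<beta> - 1) + 1 / Gamma \<beta> * abel (\<beta> - 1) ?g t" if "0 < t" for t
    using that powr_add[of t "\<beta> - 1" "1 - \<beta>"] by (simp add: x_def weighted_integral_def field_simps)
  have x_cont: "continuous_on {0<..} x"
    unfolding x_def using A_cont by (intro continuous_intros) (auto intro: continuous_on_subset)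
  show "x \<in> C_weighted (1 - \<beta>)"
    unfolding C_weighted_def
    using x_cont A_eq A_cont by (auto intro!: exI[of _ ?A] intro: continuous_on_subset)
  have f_x: "?g t = f t (x t)" if "0 < t" for t
    using that y(2)[OF that] by (simp add: rhs_def x_def)
  have g_cont: "continuous_on {0<..} ?g"
  proof -
    have "continuous_on {0<..} (\<lambda>t. (\<lambda>(t, x). f t x) (t, x t))"
      by (rule continuous_on_compose2[OF f_cont]) (auto intro!: continuous_intros x_cont)
    then show ?thesis by (rule continuous_on_cong[THEN iffD1, rotated 2]) (simp_all add: f_x)
  qed
  have g_abel0: "abel_integrable 0 ?g t" if "0 < t" for t
    using abel_integrable_weaken(1)[OF h_integrable(2)[OF that] _ h_meas that h_nonneg, of 0] \<beta>
    by (intro abel_dominated(1)[OF _ g gh]) auto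
  have abel0: "indicator {0<..<t} s *\<^sub>R ((t - s) powr 0 * ?g s) = indicator {0<..<t} s *\<^sub>R ?g s" for s t
    by (simp add: indicator_def)
  have g_int: "set_integrable lborel {0<..<t} ?g" if "0 < t" for t
    using g_abel0[OF that] unfolding set_integrable_def abel0 .
  have g_abel: "abel 0 ?g t = (LINT s:{0<..<t}|lborel. ?g s)" for t
    unfolding abel_def set_lebesgue_integral_def abel0 ..
  have "abel_integrable (- \<beta>) x t \<and> RL_integral (1 - \<beta>) x t = x0 * Gamma \<beta> + (LINT s:{0<..<t}|lborel. ?g s)"
    if t: "0 < t" for t
  proof -
    note P = abel_powr[of "1 - \<beta>" \<beta> t, simplified]
    note Q = abel_abel[of "1 - \<beta>" \<beta> ?g t, simplified]
    have Be: "Beta (1 - \<beta>) \<beta> = Gamma \<beta> * Gamma (1 - \<beta>)" by (simp add: Beta_def)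
    have xs: "(t - s) powr (- \<beta>) * x s = x0 * ((t - s) powr (- \<beta>) * s powr (\<beta> - 1)) +
        1 / Gamma \<beta> * ((t - s) powr (- \<beta>) * abel (\<beta> - 1) ?g s)" if "s \<in> {0<..<t}" for s
      using x_eq[of s] that by (simp add: distrib_left)
    have I1: "abel_integrable (- \<beta>) (\<lambda>s. s powr (\<beta> - 1)) t" using P(1) \<beta> t by simp
    have I2: "abel_integrable (- \<beta>) (abel (\<beta> - 1) ?g) t" using Q(1) g_abel0[OF t] \<beta> by simp
    have I: "abel_integrable (- \<beta>) x t"
      by (subst set_integrable_cong[OF refl refl xs]) (auto intro!: set_integral_add set_integrable_mult_right I1 I2)
    have "abel (- \<beta>) x t = x0 * abel (- \<beta>) (\<lambda>s. s powr (\<beta> - 1)) t + 1 / Gamma \<beta> * abel (- \<beta>) (abel (\<beta> - 1) ?g) t"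
    proof -
      have "abel (- \<beta>) x t = (LINT s:{0<..<t}|lborel. x0 * ((t - s) powr (- \<beta>) * s powr (\<beta> - 1)) +
        1 / Gamma \<beta> * ((t - s) powr (- \<beta>) * abel (\<beta> - 1) ?g s))"
        unfolding abel_def[of "- \<beta>" x] by (rule set_lebesgue_integral_cong) (use xs in auto)
      also have "\<dots> = x0 * abel (- \<beta>) (\<lambda>s. s powr (\<beta> - 1)) t + 1 / Gamma \<beta> * abel (- \<beta>) (abel (\<beta> - 1) ?g) t"
        by (subst set_integral_add(2)) (auto intro!: set_integrable_mult_right I1 I2 simp: abel_def[of "- \<beta>"])
      finally show ?thesis .
    qed
    also have "\<dots> = Beta (1 - \<beta>) \<beta> * (x0 + 1 / Gamma \<beta> * (LINT s:{0<..<t}|lborel. ?g s))"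
      using P(2) Q(2) g_abel0[OF t] \<beta> t by (simp add: g_abel algebra_simps)
    also have "\<dots> = Gamma (1 - \<beta>) * (x0 * Gamma \<beta> + (LINT s:{0<..<t}|lborel. ?g s))"
      using G(1) by (simp add: Be field_simps)
    finally have "RL_integral (1 - \<beta>) x t = x0 * Gamma \<beta> + (LINT s:{0<..<t}|lborel. ?g s)"
      using G(2) by (simp add: RL_integral_eq_abel[OF x_meas])
    with I show ?thesis by blast
  qed
  then have x_int: "\<And>t. 0 < t \<Longrightarrow> abel_integrable (- \<beta>) x t"
    and RL: "\<And>t. 0 < t \<Longrightarrow> RL_integral (1 - \<beta>) x t = x0 * Gamma \<beta> + (LINT s:{0<..<t}|lborel. ?g s)"
    by blast+
  have g_bdd: "\<bar>?g t\<bar> \<le> D * T0 powr (- \<gamma>)" if t: "T0 \<le> t" for t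
  proof -
    have "\<bar>?g t\<bar> \<le> D * t powr (- \<gamma>)" using gh[of t] T0(3)[OF t] t T0(1) by linarith
    also have "\<dots> \<le> D * T0 powr (- \<gamma>)"
      using t T0 \<beta> \<gamma> by (intro mult_left_mono powr_mono2') auto
    finally show ?thesis .
  qed
  have AC: "absolutely_continuous_on {0<..} (RL_integral (1 - \<beta>) x)"
    by (rule primitive_absolutely_continuous[OF g_int g_cont RL g_bdd])
  have "has_RL_derivative \<beta> x (\<lambda>t. f t (x t))"
    unfolding has_RL_derivative_def
  proof (intro conjI allI impI AC)
    fix t :: real assume t: "0 < t"
    have "(\<lambda>s. (t - s) powr (- \<beta>) * x s) \<in> borel_measurable borel" by measurable
    then show "set_integrable lebesgue {0<..<t} (\<lambda>s. (t - s) powr (- \<beta>) * x s)"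
      using x_int[OF t] by (simp add: set_integral_lebesgue_lborel)
    show "(RL_integral (1 - \<beta>) x has_real_derivative f t (x t)) (at t)"
      using primitive_has_derivative[OF g_int g_cont RL t] f_x[OF t] by simp
  qed
  moreover have "((\<lambda>t. t powr (1 - \<beta>) * x t) \<longlongrightarrow> x0) (at_right 0)"
    using weighted_integral_tendsto_0[OF y(1)]
    by (rule Lim_transform_eventually) (auto simp: A_eq eventually_at_right_field intro!: exI[of _ 1])
  ultimately show "RL_solution \<beta> f x0 x" by (simp add: RL_solution_def)
  have "(abel (\<beta> - 1) h \<longlongrightarrow> 0) at_top"
    by (rule abel_tendsto_0_at_top[OF \<beta>(1) \<gamma> T0(1) h_meas h_nonneg h_integrable(2) T0(2,3)])
  moreover have "\<forall>\<^sub>F t in at_top. norm (abel (\<beta> - 1) ?g t) \<le> abel (\<beta> - 1) h t"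
    using eventually_gt_at_top[of 0] by eventually_elim (simp add: abel_admissible(2)[OF y(1)])
  ultimately have 1: "(abel (\<beta> - 1) ?g \<longlongrightarrow> 0) at_top" by (rule Lim_null_comparison[rotated])
  have 2: "((\<lambda>t. t powr (\<beta> - 1)) \<longlongrightarrow> 0) at_top"
    by (intro tendsto_neg_powr filterlim_ident) (use \<beta> in auto)
  have "((\<lambda>t. x0 * t powr (\<beta> - 1) + 1 / Gamma \<beta> * abel (\<beta> - 1) ?g t) \<longlongrightarrow> x0 * 0 + 1 / Gamma \<beta> * 0) at_top"
    by (intro tendsto_add tendsto_mult tendsto_const 1 2)
  then have "((\<lambda>t. x0 * t powr (\<beta> - 1) + 1 / Gamma \<beta> * abel (\<beta> - 1) ?g t) \<longlongrightarrow> 0) at_top" by simp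
  moreover have "\<forall>\<^sub>F t in at_top. x0 * t powr (\<beta> - 1) + 1 / Gamma \<beta> * abel (\<beta> - 1) ?g t = x t"
    using eventually_gt_at_top[of 0] by eventually_elim (simp add: x_eq)
  ultimately show "(x \<longlongrightarrow> 0) at_top" by (rule Lim_transform_eventually)
qed

end

theorem theorem3p8:
  fixes \<beta> \<gamma> \<mu> p x0 :: real
    and l k :: "real \<Rightarrow> real"
    and f :: "real \<Rightarrow> real \<Rightarrow> real"
  assumes "0 < \<beta>" "\<beta> < \<gamma>" "\<gamma> < 1"
    and "0 \<le> \<mu>" "\<mu> \<le> 1"
    and "p > 1 / \<beta>"
    and "\<forall>t>0. 0 \<le> l t"
    and "continuous_on {0<..} (\<lambda>t. t powr ((1 - \<mu>) * (1 - \<beta>)) * l t)"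
    and "(\<lambda>t. t powr ((1 - \<mu>) * (1 - \<beta>)) * l t) \<in> Lp_loc p"
    and "\<forall>t>0. 0 \<le> k t"
    and "continuous_on {0<..} (\<lambda>t. t powr (1 - \<beta>) * k t)"
    and "(\<lambda>t. t powr (1 - \<beta>) * k t) \<in> Lp_loc p"
    and "\<exists>K\<ge>0. \<forall>t\<ge>1. t powr \<gamma> * l t \<le> K \<and> t powr \<gamma> * k t \<le> K"
    and "continuous_on ({0<..} \<times> UNIV) (\<lambda>(t, x). f t x)"
    and "\<forall>t>0. \<forall>x. \<bar>f t x\<bar> \<le> l t * abs_pow x \<mu> + k t"
  shows "\<exists>x \<in> C_weighted (1 - \<beta>). RL_solution \<beta> f x0 x \<and> (x \<longlongrightarrow> 0) at_top"
proof -
  note \<beta> = assms(1-3) and \<mu> = assms(4,5) and p = assms(6) and l0 = assms(7) and k0 = assms(10)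
    and f_le = assms(15)
  have \<beta>1: "\<beta> < 1" using \<beta> by simp
  obtain K where K: "0 \<le> K" "\<And>t. 1 \<le> t \<Longrightarrow> t powr \<gamma> * l t \<le> K" "\<And>t. 1 \<le> t \<Longrightarrow> t powr \<gamma> * k t \<le> K"
    using assms(13) by blast
  \<comment> \<open>Any number strictly between \<open>0\<close> and \<open>\<beta> - 1/p\<close> would do.\<close>
  define \<epsilon> where "\<epsilon> = (\<beta> - 1 / p) / 2"
  have "1 / p < \<beta>" using p \<beta> by (smt (verit) divide_less_eq divide_pos_pos mult.commute)
  moreover have "0 < 1 / p" using p \<beta> by (smt (verit) divide_pos_pos)
  ultimately have "0 < \<beta> - 1 / p" "\<beta> - 1 / p < 1" using \<beta>1 by linarith+
  then have \<epsilon>: "0 < \<epsilon>" "\<epsilon> < \<beta> - 1 / p" "\<epsilon> \<le> 1" by (simp_all add: \<epsilon>_def)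
  let ?L = "\<lambda>s. s powr ((1 - \<mu>) * (1 - \<beta>)) * l s" and ?M = "\<lambda>s. s powr (1 - \<beta>) * k s"
  let ?L' = "\<lambda>s. indicator {0<..} s *\<^sub>R ?L s" and ?M' = "\<lambda>s. indicator {0<..} s *\<^sub>R ?M s"
  \<comment> \<open>For \<open>s > 0\<close> this is \<open>s\<^bsup>-\<mu>(1-\<beta>)\<^esup> l(s) + k(s)\<close>, written so that the \<open>L\<^sup>p\<close> functions are visible.\<close>
  define w where "w s = s powr (\<beta> - 1) * ?L' s + s powr (\<beta> - 1) * ?M' s" for s
  have L0: "\<forall>s>0. 0 \<le> ?L s" and M0: "\<forall>s>0. 0 \<le> ?M s" using l0 k0 by auto
  note L = abel_weight_bound_Lp_loc[OF \<beta>(1) \<beta>1 p \<epsilon>(1,2) assms(8) L0 assms(9)]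
  note M = abel_weight_bound_Lp_loc[OF \<beta>(1) \<beta>1 p \<epsilon>(1,2) assms(11) M0 assms(12)]
  have w_meas: "w \<in> borel_measurable borel" using L(1) M(1) unfolding w_def by measurable
  have w_eq: "w s = s powr (- (\<mu> * (1 - \<beta>))) * l s + k s" if "0 < s" for s
  proof -
    have "s powr (\<beta> - 1) * s powr ((1 - \<mu>) * (1 - \<beta>)) = s powr (- (\<mu> * (1 - \<beta>)))"
      "s powr (\<beta> - 1) * s powr (1 - \<beta>) = 1"
      using that by (simp_all add: powr_add[symmetric] algebra_simps)
    then show ?thesis using that by (simp add: w_def mult.assoc[symmetric])
  qed
  have w0: "0 \<le> w s" if "0 < s" for s using that l0 k0 by (simp add: w_eq)
  have w_abel: "\<exists>C. \<forall>t. 0 < t \<and> t \<le> T \<longrightarrow> abel_integrable (\<beta> - 1 - \<epsilon>) w t \<and>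
      t powr (1 - \<beta>) * abel (\<beta> - 1 - \<epsilon>) w t \<le> C" if T: "0 < T" for T
  proof -
    let ?l = "\<lambda>s. s powr (\<beta> - 1) * ?L' s" and ?m = "\<lambda>s. s powr (\<beta> - 1) * ?M' s"
    obtain C1 where C1: "\<And>t. 0 < t \<Longrightarrow> t \<le> T \<Longrightarrow> abel_integrable (\<beta> - 1 - \<epsilon>) ?l t \<and>
      t powr (1 - \<beta>) * abel (\<beta> - 1 - \<epsilon>) ?l t \<le> C1" using L(2)[OF T] by blast
    obtain C2 where C2: "\<And>t. 0 < t \<Longrightarrow> t \<le> T \<Longrightarrow> abel_integrable (\<beta> - 1 - \<epsilon>) ?m t \<and>
      t powr (1 - \<beta>) * abel (\<beta> - 1 - \<epsilon>) ?m t \<le> C2" using M(2)[OF T] by blast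
    have "abel_integrable (\<beta> - 1 - \<epsilon>) w t \<and> t powr (1 - \<beta>) * abel (\<beta> - 1 - \<epsilon>) w t \<le> C1 + C2"
      if t: "0 < t" "t \<le> T" for t
    proof -
      note I = conjunct1[OF C1[OF t]] conjunct1[OF C2[OF t]]
      have "abel_integrable (\<beta> - 1 - \<epsilon>) w t"
        unfolding w_def distrib_left by (rule set_integral_add(1)[OF I])
      moreover have "abel (\<beta> - 1 - \<epsilon>) w t = abel (\<beta> - 1 - \<epsilon>) ?l t + abel (\<beta> - 1 - \<epsilon>) ?m t"
        unfolding abel_def w_def distrib_left by (rule set_integral_add(2)[OF I])
      ultimately show ?thesis using C1[OF t] C2[OF t] by (simp add: distrib_left)
    qed
    then show ?thesis by blast
  qed
  have f_w: "\<bar>f s x\<bar> \<le> w s * max 1 (s powr (1 - \<beta>) * \<bar>x\<bar>)" if s: "0 < s" for s x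
  proof -
    let ?m = "max 1 (s powr (1 - \<beta>) * \<bar>x\<bar>)"
    have "abs_pow (s powr (1 - \<beta>) * x) \<mu> \<le> ?m"
      using abs_pow_le_max[OF \<mu>, of "s powr (1 - \<beta>) * x"] by (simp add: abs_mult)
    then have "abs_pow x \<mu> \<le> s powr (- (\<mu> * (1 - \<beta>))) * ?m"
      by (subst abs_pow_scale[OF s, of _ _ "1 - \<beta>"]) (rule mult_left_mono, auto)
    then have "l s * abs_pow x \<mu> \<le> l s * (s powr (- (\<mu> * (1 - \<beta>))) * ?m)"
      using l0 s by (intro mult_left_mono) auto
    moreover have "k s * 1 \<le> k s * ?m" using k0 s by (intro mult_left_mono) auto
    moreover have "\<bar>f s x\<bar> \<le> l s * abs_pow x \<mu> + k s" using f_le s by blast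
    ultimately have "\<bar>f s x\<bar> \<le> l s * (s powr (- (\<mu> * (1 - \<beta>))) * ?m) + k s * ?m" by linarith
    then show ?thesis by (simp add: w_eq[OF s] distrib_left distrib_right mult_ac)
  qed
  have f_K: "\<bar>f s x\<bar> \<le> (2 * K) * s powr (- \<gamma>) * max 1 \<bar>x\<bar>" if s: "1 \<le> s" for s x
  proof -
    have decay: "v \<le> K * s powr (- \<gamma>)" if "s powr \<gamma> * v \<le> K" for v
      using that s by (simp add: powr_minus field_simps)
    have "l s * abs_pow x \<mu> \<le> (K * s powr (- \<gamma>)) * max 1 \<bar>x\<bar>"
      using decay[OF K(2)[OF s]] abs_pow_le_max[OF \<mu>] K(1) l0 s
      by (intro mult_mono) (auto simp: abs_pow_def)
    moreover have "k s * 1 \<le> (K * s powr (- \<gamma>)) * max 1 \<bar>x\<bar>"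
      using decay[OF K(3)[OF s]] K(1) by (intro mult_mono) auto
    moreover have "\<bar>f s x\<bar> \<le> l s * abs_pow x \<mu> + k s" using f_le s by simp
    ultimately show ?thesis by linarith
  qed
  have K2: "0 \<le> 2 * K" using K(1) by simp
  obtain h B T0 D where dv: "dominated_volterra \<beta> \<epsilon> x0 h B f"
    and T0: "1 \<le> T0" "0 \<le> D" "\<And>s. T0 \<le> s \<Longrightarrow> h s \<le> D * s powr (- \<gamma>)"
    using linear_growth_supersolution[where ?x0.0 = x0, OF \<beta> \<epsilon>(1,3) w_meas w0 w_abel K2 f_w f_K assms(14)]
    by blast
  interpret dominated_volterra \<beta> \<epsilon> x0 h B f by (rule dv)
  obtain y where y: "admissible (rhs y)" "\<And>t. 0 < t \<Longrightarrow> y t = weighted_integral (rhs y) t"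
    using fixed_point_exists by blast
  have "0 < T0" using T0(1) by simp
  note S = solution_of_fixed_point[OF y this T0(2,3) assms(2,3)]
  show ?thesis by (intro bexI[OF _ S(1)] conjI S(2,3))
qed

end
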